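(* The group of bialgebra automorphisms of ${\cal H}_R$ equals the group of Hopf algebra automorphisms of ${\cal H}_R$, and it decomposes as a semi-direct product $$Aut_{bialgebra}({\cal H}_R)=Aut_{Hopf}({\cal H}_R)=Ker(\chi)\rtimes GL(Prim({\cal H}_R)),$$ where $\chi:Aut_{bialgebra}({\cal H}_R)\to GL(Prim({\cal H}_R))$, $\Phi\mapsto\Phi|_{Prim({\cal H}_R)}$, is the restriction morphism.
   Context: ${\cal H}_R$ is the Connes–Kreimer Hopf algebra of rooted trees over $\mathbb{Q}$: the commutative polynomial algebra on isomorphism classes of rooted trees (finite connected simply connected graphs with a root, edges oriented away from the root), with coproduct the algebra morphism $\Delta(t)=1\otimes t+t\otimes1+\sum_CP^C(t)\otimes R^C(t)$ over admissible cuts $C$ (nonempty edge sets meeting each root-to-vertex path at most once; $R^C(t)$ = component containing the root, $P^C(t)$ = product of the others), counit $\varepsilon(1)=1$, $\varepsilon(t)=0$ on trees, and antipode $S$. $Prim({\cal H}_R)=\{x:\Delta(x)=x\otimes1+1\otimes x\}$, and $GL(Prim({\cal H}_R))$ is the group of linear automorphisms of this vector space. *)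

theory Defs
  imports Complex_Main "HOL-Library.Multiset" "HOL-Library.Poly_Mapping" "HOL-Library.Product_Plus"
          "HOL-Library.FuncSet" "HOL-Algebra.Coset"
begin

text \<open>Isomorphism classes of (unordered) rooted trees: a root together with
  the multiset of subtrees hanging from its children. Forests (= monomials of H_R)
  are multisets of trees; the empty forest is the unit 1.\<close>

datatype tree = Node "tree multiset"

type_synonym forest = "tree multiset"

text \<open>The Connes-Kreimer algebra H_R over Q: the polynomial algebra on trees,
  i.e. the monoid algebra of the free commutative monoid of forests.
  H_R (x) H_R is the Q-vector space with basis the pairs of forests (F,G) = F (x) G.\<close>

type_synonym HR = "forest \<Rightarrow>\<^sub>0 rat"
type_synonym HR2 = "(forest \<times> forest) \<Rightarrow>\<^sub>0 rat"

definition smult :: "rat \<Rightarrow> ('a \<Rightarrow>\<^sub>0 rat) \<Rightarrow> ('a \<Rightarrow>\<^sub>0 rat)" where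
  "smult c x = Poly_Mapping.map (\<lambda>a. c * a) x"

definition lin_ext :: "('a \<Rightarrow> ('b \<Rightarrow>\<^sub>0 rat)) \<Rightarrow> ('a \<Rightarrow>\<^sub>0 rat) \<Rightarrow> ('b \<Rightarrow>\<^sub>0 rat)" where
  "lin_ext f x = (\<Sum>k\<in>Poly_Mapping.keys x. smult (Poly_Mapping.lookup x k) (f k))"

definition basis :: "'a \<Rightarrow> ('a \<Rightarrow>\<^sub>0 rat)" where
  "basis k = Poly_Mapping.single k 1"

definition tensor :: "HR \<Rightarrow> HR \<Rightarrow> HR2" where
  "tensor x y = lin_ext (\<lambda>F. lin_ext (\<lambda>G. basis (F, G)) y) x"

definition tmap :: "(HR \<Rightarrow> HR) \<Rightarrow> (HR \<Rightarrow> HR) \<Rightarrow> HR2 \<Rightarrow> HR2" where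
  "tmap f g z = lin_ext (\<lambda>(F, G). tensor (f (basis F)) (g (basis G))) z"

text \<open>cutsum t = sum over all cuts C of t, including the empty cut, of
  P^C (x) R^C.  A cut of Node F is obtained by choosing, independently for each
  child subtree c, either to cut the edge from the root to c (c goes into the
  pruned part P) or not to cut it and to choose a (possibly empty) cut of c
  (whose trunk stays attached to the root).  This enumerates exactly the
  admissible cuts (each root-to-vertex path meets at most one cut edge), with
  multiplicity.  The product below (in the monoid algebra on pairs of forests)
  collects the pruned forest on the left and the forest of trunks hanging from the
  root on the right; the latter is then grafted on the root.\<close>

primrec cutsum :: "tree \<Rightarrow> HR2" where
  "cutsum (Node F) =
     lin_ext (\<lambda>(P, G). basis (P, {#Node G#}))
       (prod_mset (image_mset (\<lambda>c. basis ({#c#}, {#}) + cutsum c) F))"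

text \<open>Delta(t) = t (x) 1 + 1 (x) t + sum over nonempty admissible cuts P^C (x) R^C
  (the empty cut contributes 1 (x) t).\<close>
definition delta_tree :: "tree \<Rightarrow> HR2" where
  "delta_tree t = basis ({#t#}, {#}) + cutsum t"

definition delta :: "HR \<Rightarrow> HR2" where
  "delta x = lin_ext (\<lambda>F. prod_mset (image_mset delta_tree F)) x"

definition counit :: "HR \<Rightarrow> rat" where
  "counit x = Poly_Mapping.lookup x {#}"

definition Prim :: "HR set" where
  "Prim = {x. delta x = tensor x 1 + tensor 1 x}"

definition qlinear :: "(HR \<Rightarrow> HR) \<Rightarrow> bool" where
  "qlinear f \<longleftrightarrow> (\<forall>x y. f (x + y) = f x + f y) \<and> (\<forall>c x. f (smult c x) = smult c (f x))"

definition conv :: "(HR \<Rightarrow> HR) \<Rightarrow> (HR \<Rightarrow> HR) \<Rightarrow> HR \<Rightarrow> HR" where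
  "conv f g x = lin_ext (\<lambda>(F, G). f (basis F) * g (basis G)) (delta x)"

definition is_antipode :: "(HR \<Rightarrow> HR) \<Rightarrow> bool" where
  "is_antipode S \<longleftrightarrow> qlinear S \<and>
     conv S id = (\<lambda>x. smult (counit x) 1) \<and> conv id S = (\<lambda>x. smult (counit x) 1)"

definition antipode :: "HR \<Rightarrow> HR" where
  "antipode = (THE S. is_antipode S)"

definition bialgebra_aut :: "(HR \<Rightarrow> HR) \<Rightarrow> bool" where
  "bialgebra_aut \<Phi> \<longleftrightarrow> bij \<Phi> \<and> qlinear \<Phi> \<and> \<Phi> 1 = 1 \<and> (\<forall>x y. \<Phi> (x * y) = \<Phi> x * \<Phi> y) \<and>
     (\<forall>x. delta (\<Phi> x) = tmap \<Phi> \<Phi> (delta x)) \<and> (\<forall>x. counit (\<Phi> x) = counit x)"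

definition hopf_aut :: "(HR \<Rightarrow> HR) \<Rightarrow> bool" where
  "hopf_aut \<Phi> \<longleftrightarrow> bialgebra_aut \<Phi> \<and> \<Phi> \<circ> antipode = antipode \<circ> \<Phi>"

definition Aut_bialg :: "(HR \<Rightarrow> HR) monoid" where
  "Aut_bialg = \<lparr>carrier = {\<Phi>. bialgebra_aut \<Phi>}, mult = (\<circ>), one = id\<rparr>"

definition GL_Prim :: "(HR \<Rightarrow> HR) monoid" where
  "GL_Prim = \<lparr>carrier = {g. g \<in> extensional Prim \<and> bij_betw g Prim Prim \<and>
        (\<forall>x\<in>Prim. \<forall>y\<in>Prim. g (x + y) = g x + g y) \<and>
        (\<forall>c. \<forall>x\<in>Prim. g (smult c x) = smult c (g x))},
     mult = compose Prim, one = restrict id Prim\<rparr>"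

definition chi :: "(HR \<Rightarrow> HR) \<Rightarrow> (HR \<Rightarrow> HR)" where
  "chi \<Phi> = restrict \<Phi> Prim"

end

theory Submission
  imports Defs
begin

text \<open>
  Grafting a forest \<open>x\<close> on a single vertex of a primitive element, summed over the vertices and
  normalised by the weight, gives for every primitive \<open>p\<close> a Hochschild 1-cocycle
  \<open>L(x) = graft x p\<close>, i.e. \<open>\<Delta> L(x) = L(x) \<otimes> 1 + x\<^sub>1 \<otimes> L(x\<^sub>2)\<close>, with \<open>L(1) = p\<close>; this expresses that
  \<open>H\<^sub>R\<close> is a cofree coalgebra. Since \<open>H\<^sub>R\<close> is commutative, there is also a linear projection \<open>proj\<close>
  onto the primitive elements that annihilates 1 and all products of elements of the augmentation
  ideal. By cofreeness every linear automorphism \<open>g\<close> of the primitive elements lifts to a coalgebra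
  endomorphism \<open>\<Phi>\<close> with \<open>proj \<circ> \<Phi> = g \<circ> proj\<close>. Such a lift is unique, because by induction on the
  degree the difference of two lifts is a primitive element killed by \<open>proj\<close>. The same argument
  applied to \<open>\<Phi>(xy) - \<Phi>(x)\<Phi>(y)\<close> shows that \<open>\<Phi>\<close> is multiplicative. Hence restriction maps the
  subgroup of the automorphisms commuting with \<open>proj\<close> bijectively onto \<open>GL(Prim(H\<^sub>R))\<close>.
\<close>

section \<open>Linear maps on spaces of finitely supported functions\<close>

definition lin :: "(('a \<Rightarrow>\<^sub>0 rat) \<Rightarrow> ('b \<Rightarrow>\<^sub>0 rat)) \<Rightarrow> bool" where
  "lin f \<longleftrightarrow> (\<forall>x y. f (x + y) = f x + f y) \<and> (\<forall>c x. f (smult c x) = smult c (f x))"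

lemma lookup_smult [simp]: "Poly_Mapping.lookup (smult c x) k = c * Poly_Mapping.lookup x k"
  unfolding smult_def by (simp add: Poly_Mapping.map.rep_eq when_def)

lemma lookup_basis: "Poly_Mapping.lookup (basis k) l = (if k = l then 1 else 0)"
  by (simp add: basis_def lookup_single when_def)

lemma smult_simps [simp]:
  "smult 0 x = 0" "smult 1 x = x" "smult c 0 = 0" "smult a (smult b x) = smult (a * b) x"
  "smult (-1) x = - x"
  by (auto intro!: poly_mapping_eqI simp: mult.assoc)

lemma smult_distribs:
  "smult c (x + y) = smult c x + smult c y" "smult (a + b) x = smult a x + smult b x"
  "smult c (x - y) = smult c x - smult c y"
  by (auto intro!: poly_mapping_eqI simp: lookup_add lookup_minus algebra_simps)

lemma smult_mult:
  fixes x y :: "'a::monoid_add \<Rightarrow>\<^sub>0 rat"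
  shows "smult c x * y = smult c (x * y)"
  unfolding smult_def mult_map_scale_conv_mult by (simp add: mult.assoc)

lemma mult_smult:
  fixes x y :: "'a::comm_monoid_add \<Rightarrow>\<^sub>0 rat"
  shows "x * smult c y = smult c (x * y)"
  by (metis mult.commute smult_mult)

lemma basis_mult: "basis k * basis l = basis (k + l)"
  by (simp add: basis_def mult_single)

lemma basis_zero: "basis 0 = 1"
  by (simp add: basis_def)

lemma basis_empty: "basis {#} = (1 :: HR)"
  using basis_zero[where 'a = forest] by (simp del: One_nat_def)

lemma basis_empty2: "basis ({#}, {#}) = (1 :: HR2)"
  using basis_zero[where 'a = "forest \<times> forest"] by (simp add: zero_prod_def)

lemma keys_basis [simp]: "Poly_Mapping.keys (basis k) = {k}"
  by (simp add: basis_def)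

lemma lin_add: "lin f \<Longrightarrow> f (x + y) = f x + f y"
  and lin_smult: "lin f \<Longrightarrow> f (smult c x) = smult c (f x)"
  by (auto simp: lin_def)

lemma lin_zero: "lin f \<Longrightarrow> f 0 = 0"
  using lin_smult[of f 0 0] by simp

lemma lin_minus: "lin f \<Longrightarrow> f (- x) = - f x"
  using lin_smult[of f "-1" x] by simp

lemma lin_diff: "lin f \<Longrightarrow> f (x - y) = f x - f y"
  using lin_add[of f x "- y"] lin_minus[of f y] by simp

lemma lin_sum:
  assumes "lin f"
  shows "f (sum g A) = (\<Sum>a\<in>A. f (g a))"
  by (induction A rule: infinite_finite_induct) (auto simp: lin_zero[OF assms] lin_add[OF assms])

lemma qlinear_iff_lin: "qlinear f \<longleftrightarrow> lin f"
  by (simp add: qlinear_def lin_def)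

lemma lin_ext_superset:
  assumes "finite A" "Poly_Mapping.keys x \<subseteq> A"
  shows "lin_ext f x = (\<Sum>k\<in>A. smult (Poly_Mapping.lookup x k) (f k))"
  unfolding lin_ext_def
  by (rule sum.mono_neutral_left) (use assms in \<open>auto simp: not_in_keys_iff_lookup_eq_zero\<close>)

lemma lin_lin_ext: "lin (lin_ext f)"
  unfolding lin_def
proof (intro conjI allI)
  fix x y :: "'a \<Rightarrow>\<^sub>0 rat" and c
  let ?A = "Poly_Mapping.keys x \<union> Poly_Mapping.keys y"
  have "Poly_Mapping.keys (x + y) \<subseteq> ?A" by (rule keys_add)
  then show "lin_ext f (x + y) = lin_ext f x + lin_ext f y"
    by (simp add: lin_ext_superset[of ?A] lookup_add smult_distribs sum.distrib)
  have "Poly_Mapping.keys (smult c x) \<subseteq> Poly_Mapping.keys x"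
    by (metis (no_types) in_keys_iff lookup_smult mult_zero_right subsetI)
  then have "lin_ext f (smult c x) = (\<Sum>k\<in>Poly_Mapping.keys x. smult c (smult (Poly_Mapping.lookup x k) (f k)))"
    by (simp add: lin_ext_superset[of "Poly_Mapping.keys x"])
  also have "\<dots> = smult c (lin_ext f x)"
    by (rule poly_mapping_eqI) (simp add: lin_ext_def lookup_sum sum_distrib_left mult.assoc)
  finally show "lin_ext f (smult c x) = smult c (lin_ext f x)" .
qed

lemmas lin_ext_add = lin_add[OF lin_lin_ext]
  and lin_ext_smult = lin_smult[OF lin_lin_ext]

lemma lin_ext_zero [simp]: "lin_ext f 0 = 0"
  by (rule lin_zero[OF lin_lin_ext])

lemma lin_ext_basis [simp]: "lin_ext f (basis k) = f k"
  by (simp add: lin_ext_def lookup_basis)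

lemma lin_ext_one [simp]: "lin_ext f (1 :: HR) = f {#}"
  by (metis basis_empty lin_ext_basis)

lemma lin_ext_one2 [simp]: "lin_ext f (1 :: HR2) = f ({#}, {#})"
  by (metis basis_empty2 lin_ext_basis)

lemma lin_ext_id [simp]: "lin_ext basis x = x"
  by (rule poly_mapping_eqI)
     (simp add: lin_ext_def lookup_sum lookup_basis if_distrib sum.delta not_in_keys_iff_lookup_eq_zero cong: if_cong)

lemma lin_comp_lin_ext:
  assumes "lin f"
  shows "f (lin_ext g x) = lin_ext (\<lambda>k. f (g k)) x"
  by (simp add: lin_ext_def lin_sum[OF assms] lin_smult[OF assms])

lemma lin_conv_lin_ext: "lin f \<Longrightarrow> f x = lin_ext (\<lambda>k. f (basis k)) x"
  using lin_comp_lin_ext[of f basis x] by simp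

lemma lin_eqI: "lin f \<Longrightarrow> lin g \<Longrightarrow> (\<And>k. f (basis k) = g (basis k)) \<Longrightarrow> f x = g x"
  using lin_conv_lin_ext[of f x] lin_conv_lin_ext[of g x] by simp

lemma lin_ext_lin_ext: "lin_ext f (lin_ext g x) = lin_ext (\<lambda>k. lin_ext f (g k)) x"
  by (rule lin_comp_lin_ext[OF lin_lin_ext])

text \<open>As a \<open>fundef_cong\<close> rule it lets recursive calls under
  \<open>lin_ext\<close> assume that \<open>k\<close> is a key of the argument. The termination
  proofs of \<open>conv_solution\<close> and \<open>lift_correction\<close> depend on this.\<close>

lemma lin_ext_cong [fundef_cong]:
  "x = y \<Longrightarrow> (\<And>k. k \<in> Poly_Mapping.keys y \<Longrightarrow> f k = g k) \<Longrightarrow> lin_ext f x = lin_ext g y"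
  by (simp add: lin_ext_def)

lemma lin_ext_fun_add: "lin_ext (\<lambda>k. f k + g k) x = lin_ext f x + lin_ext g x"
  by (simp add: lin_ext_def smult_distribs sum.distrib)

lemma lin_ext_fun_diff: "lin_ext (\<lambda>k. f k - g k) x = lin_ext f x - lin_ext g x"
  by (simp add: lin_ext_def smult_distribs sum_subtractf)

lemma lin_ext_fun_zero [simp]: "lin_ext (\<lambda>k. 0) x = 0"
  by (simp add: lin_ext_def)

lemma lin_ext_prod_zero [simp]: "lin_ext (\<lambda>(k, l). 0) x = 0"
  by (simp add: case_prod_unfold)

lemma lin_smult_fun: "lin (smult c)"
  by (simp add: lin_def smult_distribs mult.commute)

lemma lin_mult_left: "lin (\<lambda>x. x * (y :: 'a::comm_monoid_add \<Rightarrow>\<^sub>0 rat))"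
  by (simp add: lin_def distrib_right smult_mult)

lemma lin_mult_right: "lin (\<lambda>x. (y :: 'a::comm_monoid_add \<Rightarrow>\<^sub>0 rat) * x)"
  by (simp add: lin_def distrib_left mult_smult)

lemma lin_ident: "lin (\<lambda>x. x)" and lin_id: "lin id"
  by (simp_all add: lin_def)

lemma lin_compose: "lin f \<Longrightarrow> lin g \<Longrightarrow> lin (\<lambda>x. f (g x))"
  by (simp add: lin_def)

lemma lin_fun_add: "lin f \<Longrightarrow> lin g \<Longrightarrow> lin (\<lambda>x. f x + g x)"
  by (simp add: lin_def smult_distribs algebra_simps)

lemma lin_fun_diff: "lin f \<Longrightarrow> lin g \<Longrightarrow> lin (\<lambda>x. f x - g x)"
  by (simp add: lin_def smult_distribs algebra_simps)

lemma lin_lin_ext_fun: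
  assumes "\<And>k. lin (\<lambda>x. f x k)"
  shows "lin (\<lambda>x. lin_ext (f x) z)"
  unfolding lin_def
proof (intro conjI allI)
  fix x y c
  show "lin_ext (f (x + y)) z = lin_ext (f x) z + lin_ext (f y) z"
    using lin_add[OF assms] by (simp add: lin_ext_def smult_distribs sum.distrib)
  show "lin_ext (f (smult c x)) z = smult c (lin_ext (f x) z)"
    using lin_smult[OF assms]
    by (simp add: lin_ext_def lin_sum[OF lin_smult_fun] mult.commute)
qed

text \<open>Closure rules for \<open>lin\<close>, collected so that the linearity goals left by
  \<open>lin_eqI\<close> can be solved by repeated introduction.\<close>

named_theorems lin_intros

lemmas [lin_intros] = lin_ident lin_id lin_fun_add lin_fun_diff lin_lin_ext_fun
  lin_compose[OF lin_smult_fun] lin_compose[OF lin_mult_left] lin_compose[OF lin_mult_right]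
  lin_compose[OF lin_lin_ext]

lemma lin_ext_swap:
  "lin_ext (\<lambda>k. lin_ext (\<lambda>l. f k l) y) x = lin_ext (\<lambda>l. lin_ext (\<lambda>k. f k l) x) y"
proof -
  have "lin (\<lambda>x. lin_ext (\<lambda>l. lin_ext (\<lambda>k. f k l) x) y)"
    by (intro lin_intros)
  then show ?thesis
    by (rule lin_eqI[where x = x, OF lin_lin_ext]) simp
qed

lemma lin_ext_mult_right: "lin_ext f x * (y :: 'a::comm_monoid_add \<Rightarrow>\<^sub>0 rat) = lin_ext (\<lambda>k. f k * y) x"
  by (rule lin_comp_lin_ext[OF lin_mult_left])

lemma lin_ext_mult_left: "(y :: 'a::comm_monoid_add \<Rightarrow>\<^sub>0 rat) * lin_ext f x = lin_ext (\<lambda>k. y * f k) x"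
  by (rule lin_comp_lin_ext[OF lin_mult_right])

text \<open>Both sides are bilinear, so multiplicativity may be checked on the monomial basis.\<close>
lemma lin_ext_mult_hom:
  fixes f :: "'a::comm_monoid_add \<Rightarrow> 'b::comm_monoid_add \<Rightarrow>\<^sub>0 rat"
  assumes "\<And>k l. f (k + l) = g k * h l"
  shows "lin_ext f (x * y) = lin_ext g x * lin_ext h y"
proof (rule lin_eqI[where x = x])
  fix k
  show "lin_ext f (basis k * y) = lin_ext g (basis k) * lin_ext h y"
    by (rule lin_eqI[where x = y], intro lin_intros, intro lin_intros)
       (simp add: basis_mult assms)
qed (intro lin_intros)+

lemma lin_ext_derivation:
  fixes f :: "'a::comm_monoid_add \<Rightarrow> 'a \<Rightarrow>\<^sub>0 rat"
  assumes "\<And>k l. f (k + l) = f k * basis l + basis k * f l"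
  shows "lin_ext f (x * y) = lin_ext f x * y + x * lin_ext f y"
proof (rule lin_eqI[where x = x])
  fix k
  show "lin_ext f (basis k * y) = lin_ext f (basis k) * y + basis k * lin_ext f y"
    by (rule lin_eqI[where x = y], intro lin_intros, intro lin_intros)
       (simp add: basis_mult assms)
qed (intro lin_intros)+

lemma lin_ext_times:
  fixes x y :: "'a::comm_monoid_add \<Rightarrow>\<^sub>0 rat"
  shows "lin_ext f (x * y) = lin_ext (\<lambda>k. lin_ext (\<lambda>l. f (k + l)) y) x"
proof (rule lin_eqI[where x = x])
  fix k
  show "lin_ext f (basis k * y) = lin_ext (\<lambda>k. lin_ext (\<lambda>l. f (k + l)) y) (basis k)"
    by (rule lin_eqI[where x = y], intro lin_intros, simp, intro lin_intros)
       (simp add: basis_mult)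
qed (intro lin_intros)+

section \<open>Tensors\<close>

lemma lin_tensor_left: "lin (\<lambda>x. tensor x y)"
  unfolding tensor_def by (rule lin_lin_ext)

lemma lin_tensor_right: "lin (tensor x)"
  unfolding tensor_def by (intro lin_lin_ext_fun lin_lin_ext)

lemmas [lin_intros] = lin_compose[OF lin_tensor_left] lin_compose[OF lin_tensor_right]

lemma tensor_basis [simp]: "tensor (basis F) (basis G) = basis (F, G)"
  by (simp add: tensor_def)

lemma tensor_zero [simp]: "tensor 0 y = 0" "tensor x 0 = 0"
  by (simp_all add: lin_zero[OF lin_tensor_left] lin_zero[OF lin_tensor_right])

lemma tensor_one_one [simp]: "tensor 1 1 = 1"
  by (metis basis_empty basis_empty2 tensor_basis)

lemma lin_ext_tensor:
  "lin_ext f (tensor x y) = lin_ext (\<lambda>F. lin_ext (\<lambda>G. f (F, G)) y) x"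
  by (simp add: tensor_def lin_ext_lin_ext)

lemma tensor_mult: "tensor x y * tensor x' y' = tensor (x * x') (y * y')"
proof -
  have "tensor (basis F) (basis G) * tensor x' y' = tensor (basis F * x') (basis G * y')" for F G
  proof (rule lin_eqI[where x = x'])
    fix F'
    show "tensor (basis F) (basis G) * tensor (basis F') y' = tensor (basis F * basis F') (basis G * y')"
      by (rule lin_eqI[where x = y'], intro lin_intros, intro lin_intros)
       (simp add: basis_mult)
  qed (intro lin_intros)+
  then have "tensor (basis F) y * tensor x' y' = tensor (basis F * x') (y * y')" for F
    by - (rule lin_eqI[where x = y], intro lin_intros, intro lin_intros, simp)
  then show ?thesis
    by - (rule lin_eqI[where x = x], intro lin_intros, intro lin_intros, simp)
qed

lemma lin_tmap: "lin (tmap f g)"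
  unfolding tmap_def[abs_def] by (rule lin_lin_ext)

lemma tmap_tensor:
  assumes "lin f" "lin g"
  shows "tmap f g (tensor x y) = tensor (f x) (g y)"
proof -
  have "tensor (f x) (g y) = lin_ext (\<lambda>F. tensor (f (basis F)) (g y)) x"
    by (rule lin_conv_lin_ext[OF lin_compose[OF lin_tensor_left assms(1)]])
  also have "\<dots> = lin_ext (\<lambda>F. lin_ext (\<lambda>G. tensor (f (basis F)) (g (basis G))) y) x"
    by (intro lin_ext_cong refl lin_conv_lin_ext[OF lin_compose[OF lin_tensor_right assms(2)]])
  finally show ?thesis by (simp add: tmap_def lin_ext_tensor)
qed

lemma lin_ext_tmap:
  "lin_ext u (tmap f g z) = lin_ext (\<lambda>(F, G). lin_ext u (tensor (f (basis F)) (g (basis G)))) z"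
  unfolding tmap_def lin_ext_lin_ext by (simp add: case_prod_unfold)

lemma tmap_tmap:
  assumes "lin f" "lin g"
  shows "tmap f g (tmap f' g' z) = tmap (f \<circ> f') (g \<circ> g') z"
  unfolding tmap_def[of f' g'] tmap_def[of "f \<circ> f'"]
  by (simp add: lin_comp_lin_ext[OF lin_tmap] case_prod_unfold tmap_tensor[OF assms])

section \<open>The coproduct\<close>

definition cop :: "forest \<Rightarrow> HR2" where
  "cop F = prod_mset (image_mset delta_tree F)"

definition B_plus :: "HR \<Rightarrow> HR" where
  "B_plus = lin_ext (\<lambda>F. basis {#Node F#})"

lemma delta_conv: "delta = lin_ext cop"
  by (rule ext) (simp add: delta_def cop_def[abs_def])

lemma lin_delta: "lin delta"
  by (simp add: delta_conv lin_lin_ext)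

lemma lin_B_plus: "lin B_plus"
  by (simp add: B_plus_def lin_lin_ext)

lemmas [lin_intros] = lin_compose[OF lin_delta] lin_compose[OF lin_B_plus]

lemma B_plus_basis [simp]: "B_plus (basis F) = basis {#Node F#}"
  by (simp add: B_plus_def)

lemma delta_basis [simp]: "delta (basis F) = cop F"
  by (simp add: delta_conv)

lemma cop_empty [simp]: "cop {#} = 1"
  by (simp add: cop_def)

lemma delta_one [simp]: "delta 1 = 1"
  using delta_basis[of "{#}"] by (simp add: basis_empty)

lemma cop_plus: "cop (F + G) = cop F * cop G"
  by (simp add: cop_def)

lemma delta_mult: "delta (x * y) = delta x * delta y"
  unfolding delta_conv by (rule lin_ext_mult_hom) (rule cop_plus)

lemma cop_Node:
  "cop {#Node F#} = basis ({#Node F#}, {#}) + lin_ext (\<lambda>(P, R). basis (P, {#Node R#})) (cop F)"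
  by (simp add: cop_def delta_tree_def[abs_def])

text \<open>The Hochschild 1-cocycle property of \<open>B_plus\<close>: its total cut gives the
  first summand, and every other cut of the new tree is a cut of the forest below the root.\<close>

lemma delta_B_plus:
  "delta (B_plus x) = tensor (B_plus x) 1 + lin_ext (\<lambda>(P, R). basis (P, {#Node R#})) (delta x)"
  by (rule lin_eqI[where x = x], intro lin_intros, intro lin_intros)
     (simp add: cop_Node flip: basis_empty)

section \<open>The grading by the number of vertices\<close>

primrec tsize :: "tree \<Rightarrow> nat" where
  "tsize (Node F) = Suc (sum_mset (image_mset tsize F))"

definition fsize :: "forest \<Rightarrow> nat" where
  "fsize F = sum_mset (image_mset tsize F)"

lemma fsize_empty [simp]: "fsize {#} = 0"
  by (simp add: fsize_def)

lemma fsize_plus [simp]: "fsize (F + G) = fsize F + fsize G"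
  by (simp add: fsize_def)

lemma fsize_Node [simp]: "fsize {#Node F#} = Suc (fsize F)"
  by (simp add: fsize_def)

lemma fsize_pos: "F \<noteq> {#} \<Longrightarrow> fsize F > 0"
proof -
  assume "F \<noteq> {#}"
  then obtain G H where "F = {#Node G#} + H"
    by (metis multiset_cases tree.exhaust add_mset_add_single add.commute)
  then show ?thesis by (simp del: union_mset_add_mset_left)
qed

lemma fsize_eq_0_iff [simp]: "fsize F = 0 \<longleftrightarrow> F = {#}"
  using fsize_pos[of F] by (cases "F = {#}") auto

text \<open>Forests are generated from the empty one by \<open>B_plus\<close> and disjoint union.
  The cases match the two rules that determine the coproduct, the cocycle property
  \<open>cop_Node\<close> and multiplicativity \<open>cop_plus\<close>.\<close>

lemma forest_induct [case_names empty Node plus]: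
  assumes "P {#}" and "\<And>F. P F \<Longrightarrow> P {#Node F#}" and "\<And>F G. P F \<Longrightarrow> P G \<Longrightarrow> P (F + G)"
  shows "P F"
proof (induction "fsize F" arbitrary: F rule: less_induct)
  case less
  show ?case
  proof (cases F)
    case empty
    then show ?thesis using assms(1) by simp
  next
    case (add t G)
    obtain H where t: "t = Node H" by (cases t)
    have F: "F = {#Node H#} + G" using add t by simp
    have "fsize F = Suc (fsize H) + fsize G"
      unfolding F fsize_plus fsize_Node ..
    then have "P H" and "P G" by (auto intro!: less)
    then show ?thesis unfolding F by (intro assms)
  qed
qed

lemma lookup_lin_ext:
  "Poly_Mapping.lookup (lin_ext f x) j =
     (\<Sum>k\<in>Poly_Mapping.keys x. Poly_Mapping.lookup x k * Poly_Mapping.lookup (f k) j)"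
  by (simp add: lin_ext_def lookup_sum)

lemma keys_lin_ext:
  "Poly_Mapping.keys (lin_ext f x) \<subseteq> (\<Union>k\<in>Poly_Mapping.keys x. Poly_Mapping.keys (f k))"
proof
  fix j assume "j \<in> Poly_Mapping.keys (lin_ext f x)"
  then have "(\<Sum>k\<in>Poly_Mapping.keys x. Poly_Mapping.lookup x k * Poly_Mapping.lookup (f k) j) \<noteq> 0"
    by (simp add: in_keys_iff lookup_lin_ext)
  then obtain k where "k \<in> Poly_Mapping.keys x" "Poly_Mapping.lookup (f k) j \<noteq> 0"
    by (metis (no_types, lifting) mult_zero_right sum.neutral)
  then show "j \<in> (\<Union>k\<in>Poly_Mapping.keys x. Poly_Mapping.keys (f k))"
    by (auto simp: in_keys_iff)
qed

text \<open>The coproduct is homogeneous, since a cut only distributes the vertices over the two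
  factors. Every later induction on the degree rests on this.\<close>

lemma keys_cop_subset: "Poly_Mapping.keys (cop F) \<subseteq> {(P, R). fsize P + fsize R = fsize F}"
proof (induction F rule: forest_induct)
  case empty
  then show ?case by (simp flip: basis_empty2)
next
  case (Node F)
  have "Poly_Mapping.keys (lin_ext (\<lambda>(P, R). basis (P, {#Node R#})) (cop F))
      \<subseteq> {(P, R). fsize P + fsize R = fsize {#Node F#}}"
    using Node by (intro order.trans[OF keys_lin_ext]) auto
  then show ?case
    unfolding cop_Node by (intro order.trans[OF keys_add]) auto
next
  case (plus F G)
  then show ?case
    unfolding cop_plus by (intro order.trans[OF keys_mult]) force
qed

lemma keys_cop: "(P, R) \<in> Poly_Mapping.keys (cop F) \<Longrightarrow> fsize P + fsize R = fsize F"
  using keys_cop_subset by blast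

section \<open>Counit axioms, reduced coproduct and coassociativity\<close>

lemma cop_counit_left: "lin_ext (\<lambda>(P, R). if P = {#} then f R else 0) (cop F) = f F"
proof -
  \<comment> \<open>The case \<open>f = basis\<close> is universal: applying
    \<open>lin_ext f\<close> to it gives the claim for arbitrary \<open>f\<close>.\<close>
  have "lin_ext (\<lambda>(P, R). if P = {#} then basis R else 0) (cop F) = basis F"
  proof (induction F rule: forest_induct)
    case (Node F)
    have "lin_ext (\<lambda>(P, R). if P = {#} then basis R else 0) (cop {#Node F#})
        = B_plus (lin_ext (\<lambda>(P, R). if P = {#} then basis R else 0) (cop F))"
      by (simp add: cop_Node lin_ext_add lin_ext_lin_ext lin_comp_lin_ext[OF lin_B_plus] case_prod_unfold
          if_distrib[of B_plus] lin_zero[OF lin_B_plus] cong: if_cong)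
    then show ?case by (simp add: Node)
  next
    case (plus F G)
    have "lin_ext (\<lambda>(P, R). if P = {#} then basis R else 0 :: HR) (x * y)
      = lin_ext (\<lambda>(P, R). if P = {#} then basis R else 0) x * lin_ext (\<lambda>(P, R). if P = {#} then basis R else 0) y" for x y :: HR2
      by (rule lin_ext_mult_hom) (auto simp: basis_mult)
    then show ?case by (simp add: cop_plus plus basis_mult)
  qed simp
  then have "lin_ext f (lin_ext (\<lambda>(P, R). if P = {#} then basis R else 0) (cop F)) = f F"
    by simp
  then show ?thesis
    by (simp add: lin_ext_lin_ext case_prod_unfold if_distrib[of "lin_ext f"] cong: if_cong)
qed

lemma cop_counit_right: "lin_ext (\<lambda>(P, R). if R = {#} then f P else 0) (cop F) = f F"
proof -
  have "lin_ext (\<lambda>(P, R). if R = {#} then basis P else 0) (cop F) = basis F"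
  proof (induction F rule: forest_induct)
    case (Node F)
    then show ?case
      by (simp add: cop_Node lin_ext_add lin_ext_lin_ext case_prod_unfold)
  next
    case (plus F G)
    have "lin_ext (\<lambda>(P, R). if R = {#} then basis P else 0 :: HR) (x * y)
      = lin_ext (\<lambda>(P, R). if R = {#} then basis P else 0) x * lin_ext (\<lambda>(P, R). if R = {#} then basis P else 0) y" for x y :: HR2
      by (rule lin_ext_mult_hom) (auto simp: basis_mult)
    then show ?case by (simp add: cop_plus plus basis_mult)
  qed simp
  then have "lin_ext f (lin_ext (\<lambda>(P, R). if R = {#} then basis P else 0) (cop F)) = f F"
    by simp
  then show ?thesis
    by (simp add: lin_ext_lin_ext case_prod_unfold if_distrib[of "lin_ext f"] cong: if_cong)
qed

lemma cop_split_left: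
  "lin_ext (\<lambda>(P, R). f P R) (cop F) = f {#} F + lin_ext (\<lambda>(P, R). if P \<noteq> {#} then f P R else 0) (cop F)"
proof -
  have "lin_ext (\<lambda>(P, R). f P R) (cop F) =
    lin_ext (\<lambda>k. (\<lambda>(P, R). if P = {#} then f {#} R else 0) k + (\<lambda>(P, R). if P \<noteq> {#} then f P R else 0) k) (cop F)"
    by (rule lin_ext_cong) auto
  then show ?thesis by (simp only: lin_ext_fun_add cop_counit_left)
qed

text \<open>Separates the two trivial terms from the reduced coproduct, in which both factors have
  positive degree.\<close>

lemma cop_split:
  assumes "F \<noteq> {#}"
  shows "lin_ext (\<lambda>(P, R). f P R) (cop F) =
    f {#} F + f F {#} + lin_ext (\<lambda>(P, R). if P \<noteq> {#} \<and> R \<noteq> {#} then f P R else 0) (cop F)"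
proof -
  have "lin_ext (\<lambda>(P, R). if P \<noteq> {#} then f P R else 0) (cop F) =
    lin_ext (\<lambda>k. (\<lambda>(P, R). if R = {#} then (if P \<noteq> {#} then f P {#} else 0) else 0) k
       + (\<lambda>(P, R). if P \<noteq> {#} \<and> R \<noteq> {#} then f P R else 0) k) (cop F)"
    by (rule lin_ext_cong) auto
  also have "\<dots> = f F {#} + lin_ext (\<lambda>(P, R). if P \<noteq> {#} \<and> R \<noteq> {#} then f P R else 0) (cop F)"
    using assms by (simp only: lin_ext_fun_add cop_counit_right) simp
  finally show ?thesis by (simp add: cop_split_left[of f] add.assoc)
qed

text \<open>The form in which induction hypotheses enter: factors of the reduced coproduct have
  smaller degree than \<open>F\<close>, so an expression that vanishes in smaller degrees leaves
  only the two trivial terms.\<close>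

lemma cop_reduced:
  assumes "F \<noteq> {#}"
    and "\<And>P R. P \<noteq> {#} \<Longrightarrow> R \<noteq> {#} \<Longrightarrow> fsize P < fsize F \<Longrightarrow> fsize R < fsize F \<Longrightarrow> f P R = 0"
  shows "lin_ext (\<lambda>(P, R). f P R) (cop F) = f {#} F + f F {#}"
proof -
  have "lin_ext (\<lambda>(P, R). if P \<noteq> {#} \<and> R \<noteq> {#} then f P R else 0) (cop F) = lin_ext (\<lambda>_. 0) (cop F)"
    using fsize_pos keys_cop[of _ _ F] by (intro lin_ext_cong refl) (force intro!: assms(2))
  then show ?thesis by (simp add: cop_split[OF assms(1), of f])
qed

lemma cop_cong:
  assumes "\<And>P R. fsize P + fsize R = fsize F \<Longrightarrow> f P R = g P R"
  shows "lin_ext (\<lambda>(P, R). f P R) (cop F) = lin_ext (\<lambda>(P, R). g P R) (cop F)"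
  by (rule lin_ext_cong) (auto dest!: keys_cop intro!: assms)

lemma cop_reduced_left:
  assumes "\<And>P R. fsize R < fsize F \<Longrightarrow> f P R = 0"
  shows "lin_ext (\<lambda>(P, R). f P R) (cop F) = f {#} F"
proof -
  have "lin_ext (\<lambda>(P, R). if P \<noteq> {#} then f P R else 0) (cop F) = lin_ext (\<lambda>(P, R). 0) (cop F)"
  proof (rule cop_cong)
    fix P R assume "fsize P + fsize R = fsize F"
    then show "(if P \<noteq> {#} then f P R else 0) = 0"
      using fsize_pos[of P] by (auto intro!: assms)
  qed
  then show ?thesis by (simp add: cop_split_left[of f])
qed

text \<open>The two iterated coproducts \<open>cl\<close> and \<open>cr\<close> are both
  multiplicative, and by the cocycle property they satisfy the same recursion on a tree. Letting
  \<open>T\<close> take values in any space makes the law directly usable under linear maps.\<close>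

lemma cop_coassoc:
  "lin_ext (\<lambda>(P, R). lin_ext (\<lambda>(A, B). T A B R) (cop P)) (cop F)
     = lin_ext (\<lambda>(P, R). lin_ext (\<lambda>(A, B). T P A B) (cop R)) (cop F)"
proof -
  define cl where "cl = (\<lambda>F. lin_ext (\<lambda>(P, R). lin_ext (\<lambda>(A, B). basis (A, B, R)) (cop P)) (cop F))"
  define cr where "cr = (\<lambda>F. lin_ext (\<lambda>(P, R). lin_ext (\<lambda>(A, B). basis (P, A, B)) (cop R)) (cop F))"
  have "cl F = cr F"
  proof (induction F rule: forest_induct)
    case empty
    show ?case by (simp add: cl_def cr_def)
  next
    case (Node F)
    \<comment> \<open>\<open>?J\<close> is \<open>B_plus\<close> acting on the third tensor
      factor.\<close>
    let ?J = "lin_ext (\<lambda>(A, B, C). basis (A, B, {#Node C#} :: forest) :: forest \<times> forest \<times> forest \<Rightarrow>\<^sub>0 rat)"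
    have "cl {#Node F#} = basis ({#Node F#}, {#}, {#})
        + lin_ext (\<lambda>(P, R). basis (P, {#Node R#}, {#})) (cop F) + ?J (cl F)"
      by (simp add: cl_def cop_Node lin_ext_add lin_ext_lin_ext case_prod_unfold)
    moreover have "cr {#Node F#} = basis ({#Node F#}, {#}, {#})
        + lin_ext (\<lambda>(P, R). basis (P, {#Node R#}, {#})) (cop F) + ?J (cr F)"
      by (simp add: cr_def cop_Node lin_ext_add lin_ext_lin_ext lin_ext_fun_add case_prod_unfold add.assoc)
    ultimately show ?case by (simp add: Node)
  next
    case (plus F G)
    have 1: "lin_ext (\<lambda>(A, B). basis (A, B, R + R')) (x * y) =
        lin_ext (\<lambda>(A, B). basis (A, B, R)) x * lin_ext (\<lambda>(A, B). basis (A, B, R')) y"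
      and 2: "lin_ext (\<lambda>(A, B). basis (R + R', A, B)) (x * y) =
        lin_ext (\<lambda>(A, B). basis (R, A, B)) x * lin_ext (\<lambda>(A, B). basis (R', A, B)) y"
      for R R' :: forest and x y :: HR2
      by (rule lin_ext_mult_hom; auto simp: basis_mult)+
    have "cl (F + G) = cl F * cl G"
      unfolding cl_def cop_plus by (rule lin_ext_mult_hom) (auto simp: cop_plus 1)
    moreover have "cr (F + G) = cr F * cr G"
      unfolding cr_def cop_plus by (rule lin_ext_mult_hom) (auto simp: cop_plus 2)
    ultimately show ?case by (simp add: plus)
  qed
  then have "lin_ext (\<lambda>(A, B, C). T A B C) (cl F) = lin_ext (\<lambda>(A, B, C). T A B C) (cr F)"
    by simp
  then show ?thesis
    by (simp add: cl_def cr_def lin_ext_lin_ext case_prod_unfold)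
qed

section \<open>Counit and primitive elements\<close>

text \<open>Counit followed by unit: the neutral element of convolution.\<close>

definition eps :: "HR \<Rightarrow> HR" where
  "eps x = smult (counit x) 1"

lemma lin_eps: "lin eps"
  by (simp add: lin_def eps_def counit_def lookup_add smult_distribs mult.commute)

lemma counit_basis: "counit (basis F) = (if F = {#} then 1 else 0)"
  by (auto simp: counit_def lookup_basis)

lemma counit_simps [simp]:
  "counit (x + y) = counit x + counit y" "counit (x - y) = counit x - counit y"
  "counit (smult c x) = c * counit x" "counit 1 = 1" "counit 0 = 0"
  using counit_basis[of "{#}"] by (simp_all add: counit_def lookup_add lookup_minus basis_empty)

lemma eps_basis: "eps (basis F) = (if F = {#} then 1 else 0)"
  by (simp add: eps_def counit_basis)

lemma counit_eps [simp]: "counit (eps x) = counit x"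
  by (simp add: eps_def)

lemma eps_eq_iff: "eps x = eps y \<longleftrightarrow> counit x = counit y"
  by (metis counit_eps eps_def)

lemma delta_counit_left: "lin_ext (\<lambda>(P, R). if P = {#} then f R else 0) (delta x) = lin_ext f x"
  by (simp add: delta_conv lin_ext_lin_ext cop_counit_left)

lemma lin_ext_counit_tensor:
  "lin_ext (\<lambda>(P, R). if P = {#} then f R else 0) (tensor x y) = smult (counit x) (lin_ext f y)"
proof -
  show ?thesis
    unfolding lin_ext_tensor prod.case
    by (rule lin_eqI[where x = x]) (auto simp: counit_basis lin_def lin_ext_add lin_ext_smult smult_distribs)
qed

lemma PrimI: "delta x = tensor x 1 + tensor 1 x \<Longrightarrow> x \<in> Prim"
  and PrimD: "x \<in> Prim \<Longrightarrow> delta x = tensor x 1 + tensor 1 x"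
  by (auto simp: Prim_def)

lemma Prim_zero: "0 \<in> Prim"
  by (simp add: Prim_def lin_zero[OF lin_delta])

lemma Prim_add: "x \<in> Prim \<Longrightarrow> y \<in> Prim \<Longrightarrow> x + y \<in> Prim"
  by (simp add: Prim_def lin_add[OF lin_delta] lin_add[OF lin_tensor_left] lin_add[OF lin_tensor_right])

lemma Prim_smult: "x \<in> Prim \<Longrightarrow> smult c x \<in> Prim"
  by (simp add: Prim_def lin_smult[OF lin_delta] lin_smult[OF lin_tensor_left]
      lin_smult[OF lin_tensor_right] smult_distribs)

lemma Prim_diff: "x \<in> Prim \<Longrightarrow> y \<in> Prim \<Longrightarrow> x - y \<in> Prim"
  using Prim_add[of x "smult (-1) y"] Prim_smult[of y "-1"] by simp

text \<open>Applying the counit to the left factor of the primitivity equation gives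
  \<open>x = eps x + x\<close>.\<close>

lemma Prim_counit: "x \<in> Prim \<Longrightarrow> counit x = 0"
proof -
  assume "x \<in> Prim"
  then have "lin_ext (\<lambda>(P, R). if P = {#} then basis R else 0) (delta x) = eps x + x"
    by (simp add: PrimD lin_ext_add lin_ext_counit_tensor eps_def basis_empty)
  then have "eps x = 0" by (simp add: delta_counit_left)
  then show ?thesis using eps_eq_iff[of x 0] by (simp add: lin_zero[OF lin_eps])
qed

section \<open>Grafting\<close>

text \<open>The first summand grafts \<open>X\<close> on the root, the second on a vertex below it.
  Removing a single copy of \<open>c\<close> makes equal siblings count with multiplicity.\<close>

primrec graft_tree :: "forest \<Rightarrow> tree \<Rightarrow> HR" where
  "graft_tree X (Node F) = basis {#Node (X + F)#} + B_plus (sum_mset (image_mset (\<lambda>c. basis (F - {#c#}) * graft_tree X c) F))"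

definition graft_forest :: "forest \<Rightarrow> forest \<Rightarrow> HR" where
  "graft_forest X F = (\<Sum>c\<in>#F. basis (F - {#c#}) * graft_tree X c)"

lemma graft_forest_empty [simp]: "graft_forest X {#} = 0"
  by (simp add: graft_forest_def)

lemma graft_forest_Node: "graft_forest X {#Node F#} = basis {#Node (X + F)#} + B_plus (graft_forest X F)"
  by (simp add: graft_forest_def basis_empty)

text \<open>A vertex of \<open>F + G\<close> lies in exactly one of the two forests, so grafting is
  a derivation in the forest that carries the vertices.\<close>

lemma graft_forest_plus: "graft_forest X (F + G) = graft_forest X F * basis G + basis F * graft_forest X G"
proof -
  have 1: "(\<Sum>c\<in>#F. basis (F + G - {#c#}) * graft_tree X c) = graft_forest X F * basis G" for F G
  proof -
    have "(\<Sum>c\<in>#F. basis (F + G - {#c#}) * graft_tree X c) = (\<Sum>c\<in>#F. basis G * (basis (F - {#c#}) * graft_tree X c))"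
      by (intro arg_cong[where f = sum_mset] image_mset_cong)
         (simp add: mult.assoc[symmetric] basis_mult add.commute[of G])
    then show ?thesis by (simp add: graft_forest_def sum_mset_distrib_left[symmetric] mult.commute)
  qed
  show ?thesis
    using 1[of F G] 1[of G F] by (simp add: graft_forest_def add.commute[of F] mult.commute)
qed

text \<open>\<open>gamma x y\<close> sums over the ways of grafting all trees of \<open>x\<close> on one common vertex of \<open>y\<close>.\<close>
definition gamma :: "HR \<Rightarrow> HR \<Rightarrow> HR" where
  "gamma x y = lin_ext (\<lambda>X. lin_ext (graft_forest X) y) x"

lemma lin_gamma_left: "lin (\<lambda>x. gamma x y)"
  unfolding gamma_def by (intro lin_intros)

lemma lin_gamma_right: "lin (gamma x)"
  unfolding gamma_def by (intro lin_intros)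

lemmas [lin_intros] = lin_compose[OF lin_gamma_left] lin_compose[OF lin_gamma_right]

lemma gamma_basis [simp]: "gamma (basis X) (basis F) = graft_forest X F"
  by (simp add: gamma_def)

lemma gamma_basis_left: "gamma (basis X) y = lin_ext (graft_forest X) y"
  by (simp add: gamma_def)

text \<open>Grafting nothing returns \<open>F\<close> once per vertex. This factor is what
  \<open>unweight\<close> has to cancel later.\<close>

lemma graft_forest_empty_left: "graft_forest {#} F = smult (of_nat (fsize F)) (basis F)"
proof (induction F rule: forest_induct)
  case (Node F)
  then show ?case
    by (simp add: graft_forest_Node lin_smult[OF lin_B_plus] smult_distribs)
next
  case (plus F G)
  then show ?case
    by (simp add: graft_forest_plus smult_mult mult_smult basis_mult smult_distribs)
qed simp

text \<open>Consider a cut of a grafted forest. If the chosen vertex stays in the trunk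
  \<open>R\<close>, then \<open>X\<close> may be cut as well, its part \<open>A\<close> being pruned
  and \<open>B\<close> remaining grafted; if the vertex lies in the pruned part \<open>P\<close>,
  all of \<open>X\<close> goes with it. The formal proof uses the cocycle property for a tree and
  the derivation rule for a union.\<close>

lemma delta_graft_forest:
  "delta (graft_forest X F) = lin_ext (\<lambda>(P, R).
     lin_ext (\<lambda>(A, B). tensor (basis (A + P)) (graft_forest B R)) (cop X) + tensor (graft_forest X P) (basis R)) (cop F)"
proof (induction F rule: forest_induct)
  case empty
  show ?case by (simp add: lin_zero[OF lin_delta] case_prod_unfold)
next
  case (Node F)
  let ?E = "\<lambda>(P, R). lin_ext (\<lambda>(A, B). tensor (basis (A + P)) (graft_forest B R)) (cop X) + tensor (graft_forest X P) (basis R)"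
  let ?J = "lin_ext (\<lambda>(P, R). basis (P, {#Node R#}))"
  have J_tensor: "?J (tensor x y) = tensor x (B_plus y)" for x y
    unfolding lin_ext_tensor prod.case
    by (rule lin_eqI[where x = x], intro lin_intros, intro lin_intros,
        rule lin_eqI[where x = y], intro lin_intros, intro lin_intros, simp)
  have "?J (cop (X + F)) = lin_ext (\<lambda>(P, R). lin_ext (\<lambda>(A, B). basis (A + P, {#Node (B + R)#})) (cop X)) (cop F)"
  proof -
    have "?J (x * y) = lin_ext (\<lambda>(P, R). lin_ext (\<lambda>(A, B). basis (A + P, {#Node (B + R)#})) x) y" for x y :: HR2
      unfolding case_prod_unfold
      by (rule lin_eqI[where x = x], intro lin_intros, intro lin_intros,
        rule lin_eqI[where x = y], intro lin_intros, intro lin_intros, simp add: basis_mult)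
    then show ?thesis by (simp add: cop_plus)
  qed
  then have "delta (graft_forest X {#Node F#}) = tensor (graft_forest X {#Node F#}) 1
     + lin_ext (\<lambda>(P, R). lin_ext (\<lambda>(A, B). basis (A + P, {#Node (B + R)#})) (cop X)) (cop F) + ?J (lin_ext ?E (cop F))"
    by (simp add: graft_forest_Node lin_add[OF lin_delta] lin_add[OF lin_tensor_left] delta_B_plus Node cop_Node
       algebra_simps flip: basis_empty)
  also have "?J (lin_ext ?E (cop F)) =
     lin_ext (\<lambda>(P, R). lin_ext (\<lambda>(A, B). tensor (basis (A + P)) (B_plus (graft_forest B R))) (cop X)
       + tensor (graft_forest X P) (basis {#Node R#})) (cop F)"
    by (simp add: lin_ext_lin_ext case_prod_unfold lin_ext_add lin_ext_fun_add J_tensor[unfolded case_prod_unfold])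
  finally show ?case
    by (simp add: cop_Node lin_ext_add lin_ext_lin_ext lin_ext_fun_add case_prod_unfold graft_forest_Node
       lin_add[OF lin_tensor_right] algebra_simps flip: basis_empty)
next
  case (plus F G)
  let ?E = "\<lambda>(P, R). lin_ext (\<lambda>(A, B). tensor (basis (A + P)) (graft_forest B R)) (cop X) + tensor (graft_forest X P) (basis R)"
  have "lin_ext ?E (cop F * cop G) = lin_ext ?E (cop F) * cop G + cop F * lin_ext ?E (cop G)"
    by (rule lin_ext_derivation)
       (auto simp: case_prod_unfold graft_forest_plus lin_ext_fun_add lin_ext_mult_left lin_ext_mult_right distrib_left distrib_right
         lin_add[OF lin_tensor_left] lin_add[OF lin_tensor_right] tensor_mult basis_mult algebra_simps
         simp flip: tensor_basis)
  then show ?case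
    by (simp add: graft_forest_plus lin_add[OF lin_delta] delta_mult plus cop_plus)
qed

lemma delta_gamma_Prim:
  assumes "p \<in> Prim"
  shows "delta (gamma x p) = tensor (gamma x p) 1
     + lin_ext (\<lambda>(P, R). tensor (basis P) (gamma (basis R) p)) (delta x)"
proof (rule lin_eqI[where x = x])
  fix X
  let ?E = "\<lambda>(P, R). lin_ext (\<lambda>(A, B). tensor (basis (A + P)) (graft_forest B R)) (cop X) + tensor (graft_forest X P) (basis R)"
  have "delta (gamma (basis X) p) = lin_ext ?E (delta p)"
    by (simp only: gamma_basis_left lin_comp_lin_ext[OF lin_delta] delta_graft_forest)
       (simp only: delta_conv lin_ext_lin_ext)
  \<comment> \<open>Nothing can be grafted on the empty forest, so each of the two terms of
    \<open>delta p\<close> keeps just one summand of \<open>?E\<close>.\<close>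
  also have "\<dots> = lin_ext (\<lambda>F. tensor (graft_forest X F) 1) p
     + lin_ext (\<lambda>F. lin_ext (\<lambda>(A, B). tensor (basis A) (graft_forest B F)) (cop X)) p"
    by (simp add: PrimD[OF assms] lin_ext_add lin_ext_tensor basis_empty case_prod_unfold)
  also have "lin_ext (\<lambda>F. tensor (graft_forest X F) 1) p = tensor (gamma (basis X) p) 1"
    by (simp add: gamma_basis_left lin_comp_lin_ext[OF lin_tensor_left])
  also have "lin_ext (\<lambda>F. lin_ext (\<lambda>(A, B). tensor (basis A) (graft_forest B F)) (cop X)) p
     = lin_ext (\<lambda>(A, B). tensor (basis A) (gamma (basis B) p)) (cop X)"
    by (subst lin_ext_swap) (simp add: gamma_basis_left lin_comp_lin_ext[OF lin_tensor_right] case_prod_unfold)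
  finally show "delta (gamma (basis X) p) = tensor (gamma (basis X) p) 1
     + lin_ext (\<lambda>(P, R). tensor (basis P) (gamma (basis R) p)) (delta (basis X))" by simp
qed (intro lin_intros)+

text \<open>Inverse to multiplication by the degree in positive degrees. Since division by 0 yields
  0, constants are sent to 0.\<close>

definition unweight :: "HR \<Rightarrow> HR" where
  "unweight = lin_ext (\<lambda>F. smult (1 / of_nat (fsize F)) (basis F))"

lemma lin_unweight: "lin unweight"
  unfolding unweight_def by (rule lin_lin_ext)

lemma unweight_Prim:
  assumes "p \<in> Prim"
  shows "unweight p \<in> Prim"
proof (rule PrimI)
  \<comment> \<open>\<open>?u\<close> divides by the total degree of a tensor. By homogeneity of the
    coproduct it corresponds to \<open>unweight\<close>, and on \<open>p \<otimes> 1\<close> and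
    \<open>1 \<otimes> p\<close> the total degree is that of \<open>p\<close> alone.\<close>
  let ?u = "lin_ext (\<lambda>(P, R). smult (1 / of_nat (fsize P + fsize R)) (basis (P, R)))"
  have "delta (unweight (basis F)) = ?u (delta (basis F))" for F
  proof -
    have "?u (cop F) = lin_ext (\<lambda>k. smult (1 / of_nat (fsize F)) (basis k)) (cop F)"
      by (rule lin_ext_cong) (auto simp flip: of_nat_add dest: keys_cop)
    also have "\<dots> = smult (1 / of_nat (fsize F)) (cop F)"
      by (simp flip: lin_comp_lin_ext[OF lin_smult_fun])
    finally show ?thesis by (simp add: unweight_def lin_smult[OF lin_delta])
  qed
  then have "delta (unweight x) = ?u (delta x)" for x
    by (rule lin_eqI[where x = x, rotated 2]) (intro lin_intros lin_compose[OF lin_delta] lin_unweight)+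
  then have "delta (unweight p) = ?u (tensor p 1) + ?u (tensor 1 p)"
    by (simp add: PrimD[OF assms] lin_ext_add)
  also have "?u (tensor p 1) = tensor (unweight p) 1"
    by (simp add: lin_ext_tensor unweight_def lin_comp_lin_ext[OF lin_tensor_left] lin_smult[OF lin_tensor_left] flip: basis_empty)
  also have "?u (tensor 1 p) = tensor 1 (unweight p)"
    by (simp add: lin_ext_tensor unweight_def lin_comp_lin_ext[OF lin_tensor_right] lin_smult[OF lin_tensor_right] flip: basis_empty)
  finally show "delta (unweight p) = tensor (unweight p) 1 + tensor 1 (unweight p)" .
qed

definition graft :: "HR \<Rightarrow> HR \<Rightarrow> HR" where
  "graft x p = gamma x (unweight p)"

lemma lin_graft_left: "lin (\<lambda>x. graft x p)"
  unfolding graft_def by (intro lin_intros)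

lemma lin_graft_right: "lin (graft x)"
  unfolding graft_def by (intro lin_intros lin_unweight)

lemma delta_graft:
  assumes "p \<in> Prim"
  shows "delta (graft x p) = tensor (graft x p) 1
     + lin_ext (\<lambda>(P, R). tensor (basis P) (graft (basis R) p)) (delta x)"
  unfolding graft_def by (rule delta_gamma_Prim[OF unweight_Prim[OF assms]])

text \<open>Applying the counit to the left factor of the cocycle identity gives
  \<open>graft x p = eps (graft x p) + graft x p\<close>.\<close>

lemma counit_graft:
  assumes "p \<in> Prim"
  shows "counit (graft x p) = 0"
proof -
  have "graft x p = lin_ext (\<lambda>(P, R). if P = {#} then basis R else 0) (delta (graft x p))"
    by (simp add: delta_counit_left)
  also have "\<dots> = eps (graft x p) + lin_ext (\<lambda>(P, R). if P = {#} then graft (basis R) p else 0) (delta x)"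
    unfolding delta_graft[OF assms]
    by (simp add: lin_ext_add lin_ext_counit_tensor eps_def basis_empty lin_ext_lin_ext case_prod_unfold
        lin_ext_counit_tensor[unfolded case_prod_unfold] counit_basis if_distrib[of "\<lambda>c. smult c _"] cong: if_cong)
  also have "\<dots> = eps (graft x p) + graft x p"
    unfolding delta_counit_left by (simp flip: lin_conv_lin_ext[OF lin_graft_left])
  finally have "eps (graft x p) = eps 0" by (simp add: lin_zero[OF lin_eps])
  then show ?thesis unfolding eps_eq_iff by simp
qed

text \<open>Grafting the empty forest multiplies by the degree, which \<open>unweight\<close> undoes
  except on constants; a primitive element has no constant term.\<close>

lemma graft_one:
  assumes "p \<in> Prim"
  shows "graft 1 p = p"
proof -
  have "graft 1 x = x - eps x" for x
    unfolding graft_def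
    by (rule lin_eqI[where x = x], intro lin_intros lin_unweight, intro lin_intros lin_eps)
       (auto simp: unweight_def lin_smult[OF lin_gamma_right] graft_forest_empty_left eps_basis simp flip: basis_empty)
  then show ?thesis using Prim_counit[OF assms] by (simp add: eps_def)
qed

section \<open>Convolution and the antipode\<close>

lemma lin_conv: "lin (conv f g)"
  unfolding conv_def by (intro lin_intros)

lemma conv_basis: "conv f g (basis F) = lin_ext (\<lambda>(P, R). f (basis P) * g (basis R)) (cop F)"
  by (simp add: conv_def)

lemma conv_assoc: "conv (conv f g) h x = conv f (conv g h) x"
proof (rule lin_eqI[where x = x, OF lin_conv lin_conv])
  fix F
  have "conv (conv f g) h (basis F) = lin_ext (\<lambda>(P, R).
      lin_ext (\<lambda>(A, B). f (basis A) * g (basis B) * h (basis R)) (cop P)) (cop F)"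
    by (simp add: conv_basis lin_ext_mult_right case_prod_unfold)
  also have "\<dots> = conv f (conv g h) (basis F)"
    unfolding cop_coassoc[of "\<lambda>A B R. f (basis A) * g (basis B) * h (basis R)"]
    by (simp add: conv_basis lin_ext_mult_left case_prod_unfold mult.assoc)
  finally show "conv (conv f g) h (basis F) = conv f (conv g h) (basis F)" .
qed

lemma conv_eps_left: "lin f \<Longrightarrow> conv eps f x = f x"
  by (rule lin_eqI[where x = x, OF lin_conv])
     (simp_all add: conv_basis eps_basis if_distrib[of "\<lambda>x. x * _"] cop_counit_left cong: if_cong)

lemma conv_eps_right: "lin f \<Longrightarrow> conv f eps x = f x"
  by (rule lin_eqI[where x = x, OF lin_conv])
     (simp_all add: conv_basis eps_basis if_distrib[of "\<lambda>x. _ * x"] cop_counit_right cong: if_cong)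

text \<open>Recursive solution \<open>u\<close> of \<open>conv f u = a\<close>. If
  \<open>f 1 = 1\<close>, the term with empty \<open>P\<close> is \<open>u\<close> at
  \<open>F\<close> itself, while all other terms use \<open>u\<close> in smaller degree.\<close>

function conv_solution :: "(HR \<Rightarrow> HR) \<Rightarrow> (HR \<Rightarrow> HR) \<Rightarrow> forest \<Rightarrow> HR" where
  "conv_solution f a F = a (basis F)
     - lin_ext (\<lambda>(P, R). if P \<noteq> {#} then f (basis P) * conv_solution f a R else 0) (cop F)"
  by pat_completeness auto
termination
proof (relation "measure (\<lambda>(f, a, F). fsize F)")
  fix f a :: "HR \<Rightarrow> HR" and F k P R
  assume "k \<in> Poly_Mapping.keys (cop F)" "(P, R) = k" "P \<noteq> {#}"
  then show "((f, a, R), f, a, F) \<in> measure (\<lambda>(f, a, F). fsize F)"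
    using keys_cop[of P R F] fsize_pos[of P] by simp
qed simp

declare conv_solution.simps [simp del]

lemma conv_solvable:
  assumes "f 1 = 1" "lin a"
  obtains u where "lin u" "\<And>x. conv f u x = a x"
proof
  let ?u = "lin_ext (conv_solution f a)"
  show "lin ?u" by (rule lin_lin_ext)
  fix x
  show "conv f ?u x = a x"
  proof (rule lin_eqI[where x = x, OF lin_conv assms(2)])
    fix F
    show "conv f ?u (basis F) = a (basis F)"
      unfolding conv_basis lin_ext_basis
      by (subst cop_split_left) (simp add: basis_empty assms conv_solution.simps[of f a F])
  qed
qed

lemma conv_one: "conv f g 1 = f 1 * g 1"
  using conv_basis[of f g "{#}"] by (simp add: basis_empty)

lemma eps_one [simp]: "eps 1 = 1"
  by (simp add: eps_def)

lemma is_antipode_iff: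
  "is_antipode S \<longleftrightarrow> lin S \<and> conv S id = eps \<and> conv id S = eps"
  by (simp add: is_antipode_def qlinear_iff_lin eps_def[abs_def])

text \<open>A right convolution inverse \<open>S\<close> of \<open>id\<close> exists by recursion,
  and \<open>S\<close> in turn has a right inverse \<open>T\<close>. Associativity gives
  \<open>T = id\<close>, so \<open>S\<close> is two-sided.\<close>

lemma antipode_ex: "\<exists>S. is_antipode S"
proof -
  obtain S where S: "lin S" "\<And>x. conv id S x = eps x"
    using conv_solvable[of id eps] lin_eps by auto
  have "S 1 = 1" using S(2)[of 1] by (simp add: conv_one)
  then obtain T where T: "lin T" "\<And>x. conv S T x = eps x"
    using conv_solvable[of S eps] lin_eps by auto
  have "T x = x" for x
  proof -
    have "T x = conv (conv id S) T x" using S(2) conv_eps_left[OF T(1)] by (simp add: ext[of "conv id S" eps])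
    also have "\<dots> = conv id (conv S T) x" by (rule conv_assoc)
    also have "\<dots> = x" using T(2) conv_eps_right[OF lin_id] by (simp add: ext[of "conv S T" eps])
    finally show ?thesis .
  qed
  then have "T = id" by auto
  then show ?thesis using S T by (auto simp: is_antipode_iff)
qed

lemma antipode_unique:
  assumes "is_antipode S" "is_antipode T"
  shows "S = T"
proof
  fix x
  have "S x = conv S (conv id T) x"
    using assms by (simp add: is_antipode_iff conv_eps_right)
  also have "\<dots> = conv (conv S id) T x" by (simp add: conv_assoc)
  also have "\<dots> = T x" using assms by (simp add: is_antipode_iff conv_eps_left)
  finally show "S x = T x" .
qed

lemma is_antipode_antipode: "is_antipode antipode"
  unfolding antipode_def using antipode_ex antipode_unique by (metis theI)

section \<open>A projection onto the primitive elements that annihilates products\<close>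

locale prim_projection =
  fixes proj :: "HR \<Rightarrow> HR"
  assumes lin_proj: "lin proj"
    and proj_in_Prim: "proj x \<in> Prim"
    and proj_Prim: "p \<in> Prim \<Longrightarrow> proj p = p"
    and proj_mult: "counit x = 0 \<Longrightarrow> counit y = 0 \<Longrightarrow> proj (x * y) = 0"
    and proj_one: "proj 1 = 0"

definition weight :: "HR \<Rightarrow> HR" where
  "weight = lin_ext (\<lambda>F. smult (of_nat (fsize F)) (basis F))"

text \<open>The number of vertices is additive on disjoint unions, so multiplying by it is a
  derivation.\<close>

lemma weight_mult: "weight (x * y) = weight x * y + x * weight y"
  unfolding weight_def
  by (rule lin_ext_derivation) (simp add: smult_mult mult_smult basis_mult smult_distribs)

lemma unweight_weight: "unweight (weight x) = x - eps x"
  by (rule lin_eqI[where x = x], unfold weight_def unweight_def, intro lin_intros, intro lin_intros lin_eps)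
     (auto simp: lin_ext_smult eps_basis basis_empty)

text \<open>The equation \<open>id * psi = weight\<close> characterises \<open>psi = S * weight\<close>, a Dynkin-type operator; since
  \<open>weight\<close> is a derivation and the algebra is commutative, \<open>psi\<close> is an infinitesimal character.\<close>
lemma conv_id_eq_weight_mult:
  assumes psi: "lin psi" "\<And>x. conv id psi x = weight x"
  shows "psi (x * y) = eps x * psi y + psi x * eps y"
proof -
  have psi1: "psi 1 = 0"
    using psi(2)[of 1] by (simp add: conv_one weight_def)
  have "psi (basis (F + G)) = eps (basis F) * psi (basis G) + psi (basis F) * eps (basis G)" for F G
  proof (induction "fsize F + fsize G" arbitrary: F G rule: less_induct)
    case less
    show ?case
    proof (cases "F = {#} \<or> G = {#}")
      case True
      then show ?thesis by (auto simp: basis_empty psi1)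
    next
      case False
      \<comment> \<open>Summed over both coproducts, \<open>T\<close> is the convolution of
        \<open>id\<close> with the defect of the claimed rule. By the induction hypothesis only the
        term with \<open>P\<close> and \<open>P'\<close> empty survives, and it is the defect at
        \<open>F\<close>, \<open>G\<close>.\<close>
      define T where "T P R P' R' = basis (P + P') *
        (psi (basis (R + R')) - (eps (basis R) * psi (basis R') + psi (basis R) * eps (basis R')))" for P R P' R'
      have T0: "T P R P' R' = 0" if "fsize R + fsize R' < fsize F + fsize G" for P R P' R'
        using less[OF that] by (simp add: T_def)
      have inner: "lin_ext (\<lambda>(P', R'). T P R P' R') (cop G) = T P R {#} G" if "fsize R \<le> fsize F" for P R
        by (rule cop_reduced_left) (use that in \<open>auto intro!: T0\<close>)
      have "lin_ext (\<lambda>(P, R). lin_ext (\<lambda>(P', R'). T P R P' R') (cop G)) (cop F)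
          = lin_ext (\<lambda>(P, R). T P R {#} G) (cop F)"
        by (rule cop_cong) (simp add: inner)
      also have "\<dots> = T {#} F {#} G"
        by (rule cop_reduced_left) (auto intro!: T0)
      also have "\<dots> = psi (basis (F + G))"
        using False by (simp add: T_def eps_basis basis_empty)
      finally have 1: "lin_ext (\<lambda>(P, R). lin_ext (\<lambda>(P', R'). T P R P' R') (cop G)) (cop F) = psi (basis (F + G))" .
      \<comment> \<open>Evaluated through convolutions, the same sum is the failure of
        \<open>weight\<close> to be a derivation, hence 0.\<close>
      have "lin_ext (\<lambda>(P, R). lin_ext (\<lambda>(P', R'). T P R P' R') (cop G)) (cop F)
        = conv id psi (basis (F + G))
          - (conv id eps (basis F) * conv id psi (basis G) + conv id psi (basis F) * conv id eps (basis G))"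
        unfolding conv_basis T_def cop_plus lin_ext_times lin_ext_mult_left lin_ext_mult_right
        by (simp add: case_prod_unfold lin_ext_fun_diff lin_ext_fun_add right_diff_distrib distrib_left
           lin_ext_swap[of _ "cop G" "cop F"] mult_ac basis_mult[symmetric])
      also have "\<dots> = weight (basis F * basis G) - (basis F * weight (basis G) + weight (basis F) * basis G)"
        by (simp add: psi conv_eps_right[OF lin_id] basis_mult)
      also have "\<dots> = 0" by (simp add: weight_mult)
      finally show ?thesis using 1 False by (simp add: eps_basis)
    qed
  qed
  then have *: "psi (basis F * basis G) = eps (basis F) * psi (basis G) + psi (basis F) * eps (basis G)" for F G
    by (simp add: basis_mult)
  have "psi (basis F * y) = eps (basis F) * psi y + psi (basis F) * eps y" for F
    using * by (rule lin_eqI[where x = y, rotated 2])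
      (intro lin_intros lin_compose[OF psi(1)] psi(1) lin_eps)+
  then show ?thesis
    by (rule lin_eqI[where x = x, rotated 2])
      (intro lin_intros lin_compose[OF psi(1)] psi(1) lin_eps)+
qed

text \<open>Gives access to the existence of linear left inverses of maps that are injective on a
  subspace.\<close>

interpretation HR: vector_space "smult :: rat \<Rightarrow> HR \<Rightarrow> HR"
  by unfold_locales (auto simp: smult_distribs)

lemma linear_iff_lin: "Vector_Spaces.linear smult smult f \<longleftrightarrow> lin (f :: HR \<Rightarrow> HR)"
  by (auto simp: lin_def Vector_Spaces.linear_iff HR.vector_space_axioms)

text \<open>On primitive elements \<open>psi\<close> agrees with \<open>weight\<close>, which is
  injective there because \<open>unweight\<close> undoes it. A linear left inverse \<open>g\<close>
  of \<open>psi\<close> on \<open>Prim\<close> with range in \<open>Prim\<close> makes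
  \<open>g \<circ> psi\<close> the projection, and it kills products because \<open>psi\<close>
  does.\<close>

lemma prim_projection_ex: "\<exists>proj. prim_projection proj"
proof -
  have "lin weight" unfolding weight_def by (rule lin_lin_ext)
  then obtain psi where psi: "lin psi" "\<And>x. conv id psi x = weight x"
    using conv_solvable[of id weight] by auto
  have psi1: "psi 1 = 0"
    using psi(2)[of 1] by (simp add: conv_one weight_def)
  have psi_Prim: "psi p = weight p" if "p \<in> Prim" for p
  proof -
    have "conv id psi p = lin_ext (\<lambda>F. basis F * psi 1) p + lin_ext (\<lambda>F. psi (basis F)) p"
      by (simp add: conv_def PrimD[OF that] lin_ext_add lin_ext_tensor basis_empty)
    then show ?thesis by (simp add: psi psi1 flip: lin_conv_lin_ext[OF psi(1)])
  qed
  interpret vp: vector_space_pair "smult :: rat \<Rightarrow> HR \<Rightarrow> HR" "smult :: rat \<Rightarrow> HR \<Rightarrow> HR" ..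
  have "inj_on psi Prim"
  proof (rule inj_onI)
    fix p q assume "p \<in> Prim" "q \<in> Prim" "psi p = psi q"
    then have "unweight (weight p) = unweight (weight q)" by (simp add: psi_Prim)
    then show "p = q" using \<open>p \<in> Prim\<close> \<open>q \<in> Prim\<close> by (simp add: unweight_weight eps_def Prim_counit)
  qed
  moreover have "HR.subspace Prim"
    by (auto simp: HR.subspace_def Prim_zero Prim_add Prim_smult)
  ultimately obtain g where g: "range g \<subseteq> Prim" "lin g" "\<forall>p\<in>Prim. g (psi p) = p"
    using vp.linear_exists_left_inverse_on[of psi Prim] psi(1) by (auto simp: linear_iff_lin)
  have "prim_projection (\<lambda>x. g (psi x))"
  proof
    show "lin (\<lambda>x. g (psi x))" by (rule lin_compose[OF g(2) psi(1)])
    show "g (psi (x * y)) = 0" if "counit x = 0" "counit y = 0" for x y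
      using that by (simp add: conv_id_eq_weight_mult[OF psi] eps_def lin_zero[OF g(2)])
  qed (use g psi1 in \<open>auto simp: lin_zero[OF g(2)]\<close>)
  then show ?thesis by blast
qed

section \<open>Coalgebra endomorphisms\<close>

definition coalg_hom :: "(HR \<Rightarrow> HR) \<Rightarrow> bool" where
  "coalg_hom \<Phi> \<longleftrightarrow> lin \<Phi> \<and> \<Phi> 1 = 1 \<and> (\<forall>x. delta (\<Phi> x) = tmap \<Phi> \<Phi> (delta x)) \<and> (\<forall>x. counit (\<Phi> x) = counit x)"

lemma bialgebra_aut_iff:
  "bialgebra_aut \<Phi> \<longleftrightarrow> bij \<Phi> \<and> coalg_hom \<Phi> \<and> (\<forall>x y. \<Phi> (x * y) = \<Phi> x * \<Phi> y)"
  by (auto simp: bialgebra_aut_def coalg_hom_def qlinear_iff_lin)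

lemma tmap_id: "tmap id id z = z"
  by (simp add: tmap_def flip: case_prod_eta) 

lemma coalg_hom_id: "coalg_hom id"
  by (simp add: coalg_hom_def lin_id tmap_id)

lemma coalg_hom_comp: "coalg_hom \<Phi> \<Longrightarrow> coalg_hom \<Psi> \<Longrightarrow> coalg_hom (\<Phi> \<circ> \<Psi>)"
  by (auto simp: coalg_hom_def tmap_tmap comp_def lin_compose)

lemma coalg_hom_Prim:
  assumes "coalg_hom \<Phi>" "p \<in> Prim"
  shows "\<Phi> p \<in> Prim"
  using assms
  by (auto simp: coalg_hom_def tmap_tensor PrimD lin_add[OF lin_tmap] intro!: PrimI)

lemma coalg_hom_inverse:
  assumes "coalg_hom \<Phi>" and inv: "\<And>x. \<Phi> (\<Psi> x) = x" "\<And>x. \<Psi> (\<Phi> x) = x"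
  shows "coalg_hom \<Psi>"
proof -
  have lin: "lin \<Phi>" "\<Phi> 1 = 1" using assms(1) by (auto simp: coalg_hom_def)
  have lin': "lin \<Psi>"
    unfolding lin_def
  proof (intro conjI allI)
    show "\<Psi> (x + y) = \<Psi> x + \<Psi> y" for x y
      using lin_add[OF lin(1), of "\<Psi> x" "\<Psi> y"] inv by metis
    show "\<Psi> (smult c x) = smult c (\<Psi> x)" for c x
      using lin_smult[OF lin(1), of c "\<Psi> x"] inv by metis
  qed
  have "delta (\<Psi> x) = tmap \<Psi> \<Psi> (delta x)" for x
  proof -
    have "\<Psi> \<circ> \<Phi> = id" using inv by auto
    then have "tmap \<Psi> \<Psi> (delta (\<Phi> (\<Psi> x))) = delta (\<Psi> x)"
      using assms(1) by (simp add: coalg_hom_def tmap_tmap[OF lin' lin'] tmap_id)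
    then show ?thesis by (simp add: inv)
  qed
  moreover have "counit (\<Psi> x) = counit x" for x
    using assms(1) inv by (metis coalg_hom_def)
  moreover have "\<Psi> 1 = 1" using lin(2) inv by metis
  ultimately show ?thesis using lin' by (simp add: coalg_hom_def)
qed

section \<open>Rigidity and multiplicativity of coalgebra endomorphisms\<close>

context prim_projection
begin

lemma Prim_eq_0: "d \<in> Prim \<Longrightarrow> proj d = 0 \<Longrightarrow> d = 0"
  by (simp add: proj_Prim)

text \<open>If \<Psi> is the identity in smaller degrees, the reduced coproduct of
  \<open>\<Psi> (basis F) - basis F\<close> vanishes. The difference is then primitive, and
  \<open>proj\<close> sees that it is 0.\<close>

lemma coalg_hom_eq_id:
  assumes "coalg_hom \<Psi>" "\<And>x. proj (\<Psi> x) = proj x"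
  shows "\<Psi> = id"
proof -
  have lin: "lin \<Psi>" and one: "\<Psi> 1 = 1" and delta: "\<And>x. delta (\<Psi> x) = tmap \<Psi> \<Psi> (delta x)"
    using assms(1) by (auto simp: coalg_hom_def)
  have "\<Psi> (basis F) = basis F" for F
  proof (induction "fsize F" arbitrary: F rule: less_induct)
    case less
    show ?case
    proof (cases "F = {#}")
      case True
      then show ?thesis by (simp add: basis_empty one)
    next
      case False
      let ?d = "\<Psi> (basis F) - basis F"
      have "delta ?d = tmap \<Psi> \<Psi> (cop F) - cop F"
        by (simp add: lin_diff[OF lin_delta] delta)
      also have "\<dots> = lin_ext (\<lambda>(P, R). tensor (\<Psi> (basis P)) (\<Psi> (basis R)) - tensor (basis P) (basis R)) (cop F)"
        using tmap_id[of "cop F"] by (simp add: tmap_def lin_ext_fun_diff case_prod_unfold)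
      also have "\<dots> = tensor ?d 1 + tensor 1 ?d"
        by (subst cop_reduced[OF False])
           (simp_all add: less basis_empty one lin_diff[OF lin_tensor_left] lin_diff[OF lin_tensor_right] del: tensor_basis)
      finally have "?d \<in> Prim" by (rule PrimI)
      moreover have "proj ?d = 0" by (simp add: lin_diff[OF lin_proj] assms(2))
      ultimately have "?d = 0" by (rule Prim_eq_0)
      then show ?thesis by simp
    qed
  qed
  then show ?thesis
    by (intro ext) (rule lin_eqI[OF lin lin_id], simp)
qed

text \<open>By induction on the total degree the multiplicativity defect is primitive.
  \<open>proj\<close> kills it, by assumption on \<open>\<Phi> (x * y)\<close> and by
  \<open>proj_mult\<close> on the product of the images.\<close>

lemma coalg_hom_mult:
  assumes "coalg_hom \<Phi>" and proj0: "\<And>x y. counit x = 0 \<Longrightarrow> counit y = 0 \<Longrightarrow> proj (\<Phi> (x * y)) = 0"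
  shows "\<Phi> (x * y) = \<Phi> x * \<Phi> y"
proof -
  have lin: "lin \<Phi>" and one: "\<Phi> 1 = 1" and delta: "\<And>x. delta (\<Phi> x) = tmap \<Phi> \<Phi> (delta x)"
    and counit: "\<And>x. counit (\<Phi> x) = counit x"
    using assms(1) by (auto simp: coalg_hom_def)
  have "\<Phi> (basis (F + G)) = \<Phi> (basis F) * \<Phi> (basis G)" for F G
  proof (induction "fsize F + fsize G" arbitrary: F G rule: less_induct)
    case less
    show ?case
    proof (cases "F = {#} \<or> G = {#}")
      case True
      then show ?thesis by (auto simp: basis_empty one)
    next
      case False
      then have F: "F \<noteq> {#}" and G: "G \<noteq> {#}" by auto
      let ?d = "\<Phi> (basis (F + G)) - \<Phi> (basis F) * \<Phi> (basis G)"
      define T where "T P R P' R' = tensor (\<Phi> (basis (P + P'))) (\<Phi> (basis (R + R')))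
        - tensor (\<Phi> (basis P) * \<Phi> (basis P')) (\<Phi> (basis R) * \<Phi> (basis R'))" for P R P' R'
      have T0: "T P R P' R' = 0" if "fsize P + fsize P' < fsize F + fsize G" "fsize R + fsize R' < fsize F + fsize G" for P R P' R'
        using less[OF that(1)] less[OF that(2)] by (simp add: T_def)
      have inner: "lin_ext (\<lambda>(P', R'). T P R P' R') (cop G) = T P R {#} G + T P R G {#}"
        if "fsize R \<le> fsize F" "fsize P \<le> fsize F" for P R
        by (rule cop_reduced[OF G]) (use that in \<open>auto intro!: T0\<close>)
      have "delta ?d = lin_ext (\<lambda>(P, R). lin_ext (\<lambda>(P', R'). T P R P' R') (cop G)) (cop F)"
        by (simp add: lin_diff[OF lin_delta] delta delta_mult cop_plus)
           (simp add: T_def tmap_def lin_ext_times lin_ext_mult_left lin_ext_mult_right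
             case_prod_unfold lin_ext_fun_diff lin_ext_swap[of _ "cop G" "cop F"] tensor_mult)
      also have "\<dots> = lin_ext (\<lambda>(P, R). T P R {#} G + T P R G {#}) (cop F)"
        by (rule cop_cong) (simp add: inner)
      \<comment> \<open>The two mixed terms have factors of degrees \<open>fsize F\<close> and
        \<open>fsize G\<close>, both below the total degree, so they vanish. The outer terms become
        \<open>1 \<otimes> ?d\<close> and \<open>?d \<otimes> 1\<close>.\<close>
      also have "\<dots> = T {#} F {#} G + T {#} F G {#} + (T F {#} {#} G + T F {#} G {#})"
        using fsize_pos[OF F] fsize_pos[OF G] by (intro cop_reduced[OF F]) (auto simp: T0)
      also have "\<dots> = T {#} F {#} G + T F {#} G {#}"
        using fsize_pos[OF F] fsize_pos[OF G] by (simp add: T0)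
      finally have "delta ?d = tensor ?d 1 + tensor 1 ?d"
        by (simp add: T_def basis_empty one lin_diff[OF lin_tensor_left] lin_diff[OF lin_tensor_right])
      then have "?d \<in> Prim" by (rule PrimI)
      moreover have "proj ?d = 0"
        using False
        by (simp add: lin_diff[OF lin_proj] proj_mult counit counit_basis proj0 flip: basis_mult)
      ultimately have "?d = 0" by (rule Prim_eq_0)
      then show ?thesis by simp
    qed
  qed
  then have *: "\<Phi> (basis F * basis G) = \<Phi> (basis F) * \<Phi> (basis G)" for F G
    by (simp add: basis_mult)
  have "\<Phi> (basis F * y) = \<Phi> (basis F) * \<Phi> y" for F
    using * by (rule lin_eqI[where x = y, rotated 2]) (intro lin_intros lin_compose[OF lin] lin)+
  then show ?thesis
    by (rule lin_eqI[where x = x, rotated 2]) (intro lin_intros lin_compose[OF lin] lin)+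
qed

end

text \<open>The contribution of the reduced coproduct to the lift. The first argument of
  \<open>graft\<close> is the lift at \<open>P\<close>, whose counit term is absent because
  \<open>P\<close> is nonempty; the second is the primitive element used at
  \<open>R\<close>.\<close>

function lift_correction :: "(HR \<Rightarrow> HR) \<Rightarrow> (HR \<Rightarrow> HR) \<Rightarrow> forest \<Rightarrow> HR" where
  "lift_correction proj h F = lin_ext (\<lambda>(P, R). if P \<noteq> {#} \<and> R \<noteq> {#}
     then graft (h (basis P) + lift_correction proj h P - proj (lift_correction proj h P)) (h (basis R) - proj (lift_correction proj h R))
     else 0) (cop F)"
  by pat_completeness auto
termination
proof (relation "measure (\<lambda>(proj, h, F). fsize F)")
  fix proj h :: "HR \<Rightarrow> HR" and F k P R
  assume *: "k \<in> Poly_Mapping.keys (cop F)" "(P, R) = k" "P \<noteq> {#} \<and> R \<noteq> {#}"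
  then show "((proj, h, R), proj, h, F) \<in> measure (\<lambda>(proj, h, F). fsize F)"
    using keys_cop[of P R F] fsize_pos[of P] by simp
  from * show "((proj, h, P), proj, h, F) \<in> measure (\<lambda>(proj, h, F). fsize F)"
    using keys_cop[of P R F] fsize_pos[of R] by simp
  \<comment> \<open>The body calls the function at \<open>P\<close> twice, so the same goal arises
    again.\<close>
  from * show "((proj, h, P), proj, h, F) \<in> measure (\<lambda>(proj, h, F). fsize F)"
    using keys_cop[of P R F] fsize_pos[of R] by simp
qed simp

declare lift_correction.simps [simp del]

context prim_projection
begin

text \<open>The recursion amounts to \<open>\<Phi>(x) = \<epsilon>(x) + graft (\<Phi> x\<^sub>1) (f x\<^sub>2)\<close> in Sweedler notation. The
  cocycle property of grafting makes any such \<open>\<Phi>\<close> a coalgebra morphism; \<open>f\<close> is adjusted degree by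
  degree so that \<open>proj \<circ> \<Phi> = h\<close>.\<close>
lemma coalg_hom_lift:
  assumes "lin h" and h_Prim: "\<And>x. h x \<in> Prim" and "h 1 = 0"
  obtains \<Phi> where "coalg_hom \<Phi>" "\<And>x. proj (\<Phi> x) = h x"
proof
  define z where "z = lift_correction proj h"
  \<comment> \<open>Thus \<open>phi F = eps (basis F) + f F + z F\<close>. Subtracting
    \<open>proj (z F)\<close> keeps \<open>f F\<close> primitive and makes \<open>proj\<close> of
    the sum equal to \<open>h (basis F)\<close>.\<close>
  define f where "f F = h (basis F) - proj (z F)" for F
  define phi where "phi F = eps (basis F) + h (basis F) + z F - proj (z F)" for F
  let ?\<Phi> = "lin_ext phi"
  have f_Prim: "f F \<in> Prim" for F
    unfolding f_def by (intro Prim_diff h_Prim proj_in_Prim)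
  have z_eq: "z F = lin_ext (\<lambda>(P, R). if P \<noteq> {#} \<and> R \<noteq> {#} then graft (phi P) (f R) else 0) (cop F)" for F
    unfolding z_def
    by (subst lift_correction.simps, rule lin_ext_cong) (auto simp: phi_def f_def z_def eps_basis)
  have z0: "z {#} = 0" by (subst z_eq) simp
  have f0: "f {#} = 0" by (simp add: f_def z0 basis_empty assms(3) lin_zero[OF lin_proj])
  have phi0: "phi {#} = 1" by (simp add: phi_def z0 basis_empty assms(3) lin_zero[OF lin_proj])
  have phi_eq: "phi F = eps (basis F) + lin_ext (\<lambda>(P, R). graft (phi P) (f R)) (cop F)" for F
  proof (cases "F = {#}")
    case True
    then show ?thesis by (simp add: phi0 f0 eps_basis lin_zero[OF lin_graft_right])
  next
    case False
    \<comment> \<open>The term with empty \<open>P\<close> is \<open>graft 1 (f F) = f F\<close>,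
      and the one with empty \<open>R\<close> vanishes because \<open>f {#} = 0\<close>.\<close>
    have "lin_ext (\<lambda>(P, R). graft (phi P) (f R)) (cop F) = f F + z F"
      unfolding cop_split[OF False, of "\<lambda>P R. graft (phi P) (f R)"] z_eq[of F]
      by (simp add: f0 phi0 lin_zero[OF lin_graft_right] graft_one[OF f_Prim])
    then show ?thesis by (simp add: phi_def f_def)
  qed
  have delta_phi: "delta (phi F) = lin_ext (\<lambda>(P, R). tensor (phi P) (phi R)) (cop F)" for F
  proof (induction "fsize F" arbitrary: F rule: less_induct)
    case less
    show ?case
    proof (cases "F = {#}")
      case True
      then show ?thesis by (simp add: phi0)
    next
      case False
      then have phi_F: "phi F = lin_ext (\<lambda>(P, R). graft (phi P) (f R)) (cop F)"
        by (subst phi_eq) (simp add: eps_basis)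
      have "delta (graft (phi P) (f R)) = tensor (graft (phi P) (f R)) 1
          + lin_ext (\<lambda>(A, B). tensor (phi A) (graft (phi B) (f R))) (cop P)"
        if "(P, R) \<in> Poly_Mapping.keys (cop F)" for P R
      \<comment> \<open>For empty \<open>R\<close> both sides are 0. Otherwise \<open>P\<close> has
        smaller degree and the induction hypothesis applies to it.\<close>
      proof (cases "R = {#}")
        case True
        then show ?thesis
          by (simp add: f0 lin_zero[OF lin_graft_right] lin_zero[OF lin_delta] case_prod_unfold)
      next
        case False
        then have "fsize P < fsize F" using keys_cop[OF that] fsize_pos[OF False] by simp
        then have "delta (phi P) = lin_ext (\<lambda>(P, R). tensor (phi P) (phi R)) (cop P)" by (rule less)
        then have "tmap id (\<lambda>y. graft y (f R)) (delta (phi P))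
           = lin_ext (\<lambda>(A, B). tensor (phi A) (graft (phi B) (f R))) (cop P)"
          by (simp add: lin_comp_lin_ext[OF lin_tmap] case_prod_unfold tmap_tensor[OF lin_id lin_graft_left])
        then show ?thesis by (simp add: delta_graft[OF f_Prim] tmap_def)
      qed
      then have "delta (phi F) = lin_ext (\<lambda>(P, R). tensor (graft (phi P) (f R)) 1
          + lin_ext (\<lambda>(A, B). tensor (phi A) (graft (phi B) (f R))) (cop P)) (cop F)"
        unfolding phi_F lin_comp_lin_ext[OF lin_delta] by (intro lin_ext_cong) auto
      also have "\<dots> = tensor (phi F) 1
          + lin_ext (\<lambda>(P, R). lin_ext (\<lambda>(A, B). tensor (phi A) (graft (phi B) (f R))) (cop P)) (cop F)"
        by (simp add: case_prod_unfold lin_ext_fun_add phi_F lin_comp_lin_ext[OF lin_tensor_left])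
      also have "lin_ext (\<lambda>(P, R). lin_ext (\<lambda>(A, B). tensor (phi A) (graft (phi B) (f R))) (cop P)) (cop F)
        = lin_ext (\<lambda>(P, R). lin_ext (\<lambda>(A, B). tensor (phi P) (graft (phi A) (f B))) (cop R)) (cop F)"
        by (rule cop_coassoc)
      \<comment> \<open>By \<open>phi_eq\<close> the inner sum is
        \<open>phi R - eps (basis R)\<close>. The counit part, present only for empty
        \<open>R\<close>, adds up to \<open>phi F \<otimes> 1\<close> and cancels the first cocycle
        term.\<close>
      also have "\<dots> = lin_ext (\<lambda>(P, R). tensor (phi P) (phi R) - (if R = {#} then tensor (phi P) 1 else 0)) (cop F)"
      proof (rule lin_ext_cong, rule refl, clarify)
        fix P R
        have "lin_ext (\<lambda>(A, B). graft (phi A) (f B)) (cop R) = phi R - eps (basis R)"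
          by (subst phi_eq) simp
        then have "tensor (phi P) (lin_ext (\<lambda>(A, B). graft (phi A) (f B)) (cop R)) = tensor (phi P) (phi R - eps (basis R))"
          by simp
        then show "lin_ext (\<lambda>(A, B). tensor (phi P) (graft (phi A) (f B))) (cop R)
          = tensor (phi P) (phi R) - (if R = {#} then tensor (phi P) 1 else 0)"
          by (auto simp: lin_comp_lin_ext[OF lin_tensor_right] case_prod_unfold lin_diff[OF lin_tensor_right] eps_basis)
      qed
      also have "\<dots> = lin_ext (\<lambda>(P, R). tensor (phi P) (phi R)) (cop F) - tensor (phi F) 1"
        using cop_counit_right[of "\<lambda>P. tensor (phi P) 1" F] by (simp add: case_prod_unfold lin_ext_fun_diff)
      finally show ?thesis by simp
    qed
  qed
  have "delta (?\<Phi> x) = tmap ?\<Phi> ?\<Phi> (delta x)" for x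
    by (simp add: lin_comp_lin_ext[OF lin_delta] delta_phi)
       (simp add: delta_conv tmap_def lin_ext_lin_ext)
  moreover have "counit (?\<Phi> x) = counit x" for x
  proof -
    have "eps (graft x (f R)) = 0" for x R
      by (simp add: eps_def counit_graft[OF f_Prim])
    then have "eps (z F) = 0" for F
      by (subst z_eq) (simp add: lin_comp_lin_ext[OF lin_eps] case_prod_unfold if_distrib[of eps]
         lin_zero[OF lin_eps] cong: if_cong)
    moreover have "eps p = 0" if "p \<in> Prim" for p
      using Prim_counit[OF that] by (simp add: eps_def)
    ultimately have "eps (phi F) = eps (basis F)" for F
      using h_Prim proj_in_Prim
      by (simp add: phi_def lin_add[OF lin_eps] lin_diff[OF lin_eps]) (simp add: eps_def)
    then have "eps (?\<Phi> x) = eps x"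
      by (simp add: lin_comp_lin_ext[OF lin_eps] flip: lin_conv_lin_ext[OF lin_eps])
    then show ?thesis by (simp add: eps_eq_iff)
  qed
  ultimately show "coalg_hom ?\<Phi>"
    by (simp add: coalg_hom_def lin_lin_ext phi0)
  fix x
  show "proj (?\<Phi> x) = h x"
  proof (rule lin_eqI[where x = x, OF lin_compose[OF lin_proj lin_lin_ext] assms(1)])
    fix F
    have "proj (eps (basis F)) = 0" by (simp add: eps_basis proj_one lin_zero[OF lin_proj])
    then show "proj (?\<Phi> (basis F)) = h (basis F)"
      by (simp add: phi_def lin_add[OF lin_proj] lin_diff[OF lin_proj] proj_Prim proj_in_Prim h_Prim)
  qed
qed

end

section \<open>The automorphism groups\<close>

lemma bialgebra_aut_inverse:
  assumes "bialgebra_aut \<Phi>"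
  obtains \<Psi> where "bialgebra_aut \<Psi>" "\<And>x. \<Phi> (\<Psi> x) = x" "\<And>x. \<Psi> (\<Phi> x) = x"
proof -
  let ?\<Psi> = "inv_into UNIV \<Phi>"
  have bij: "bij \<Phi>" and mult: "\<And>x y. \<Phi> (x * y) = \<Phi> x * \<Phi> y" and "coalg_hom \<Phi>"
    using assms by (auto simp: bialgebra_aut_iff)
  have inv: "\<Phi> (?\<Psi> x) = x" "?\<Psi> (\<Phi> x) = x" for x
    using bij by (auto simp: bij_def surj_f_inv_f)
  have "?\<Psi> (x * y) = ?\<Psi> x * ?\<Psi> y" for x y
    using mult[of "?\<Psi> x" "?\<Psi> y"] inv by metis
  then have "bialgebra_aut ?\<Psi>"
    using coalg_hom_inverse[OF \<open>coalg_hom \<Phi>\<close> inv] bij_imp_bij_inv[OF bij] by (simp add: bialgebra_aut_iff)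
  then show ?thesis using that inv by blast
qed

lemma mult_tensor:
  fixes f g :: "HR \<Rightarrow> HR"
  assumes "lin f" "lin g"
  shows "lin_ext (\<lambda>(F, G). f (basis F) * g (basis G)) (tensor x y) = f x * g y"
proof -
  have "lin_ext (\<lambda>F. lin_ext (\<lambda>G. f (basis F) * g (basis G)) y) x = lin_ext (\<lambda>F. f (basis F) * g y) x"
    by (simp add: lin_conv_lin_ext[OF lin_compose[OF lin_mult_right assms(2)], symmetric])
  also have "\<dots> = f x * g y"
    by (rule lin_conv_lin_ext[OF lin_compose[OF lin_mult_left assms(1)], symmetric])
  finally show ?thesis by (simp add: lin_ext_tensor)
qed

text \<open>\<Psi> passes through the coproduct and \<Phi> through the product. For mutually inverse
  maps this says that conjugation respects convolution.\<close>

lemma conv_conjugate: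
  assumes "bialgebra_aut \<Phi>" "bialgebra_aut \<Psi>" "lin f" "lin g"
  shows "conv (\<lambda>x. \<Phi> (f (\<Psi> x))) (\<lambda>x. \<Phi> (g (\<Psi> x))) x = \<Phi> (conv f g (\<Psi> x))"
proof -
  have \<Phi>: "lin \<Phi>" "\<And>x y. \<Phi> (x * y) = \<Phi> x * \<Phi> y" and \<Psi>: "\<And>x. delta (\<Psi> x) = tmap \<Psi> \<Psi> (delta x)"
    using assms by (auto simp: bialgebra_aut_iff coalg_hom_def)
  show ?thesis
    by (simp add: conv_def \<Psi> lin_ext_tmap mult_tensor[OF assms(3,4)] lin_comp_lin_ext[OF \<Phi>(1)]
        case_prod_unfold \<Phi>(2) mult_tensor[OF assms(3,4), unfolded case_prod_unfold])
qed

text \<open>The conjugate of the antipode by \<Phi> satisfies the antipode equations again, so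
  uniqueness of the antipode forces \<Phi> to commute with it.\<close>

lemma bialgebra_aut_antipode:
  assumes "bialgebra_aut \<Phi>"
  shows "\<Phi> \<circ> antipode = antipode \<circ> \<Phi>"
proof -
  obtain \<Psi> where \<Psi>: "bialgebra_aut \<Psi>" "\<And>x. \<Phi> (\<Psi> x) = x" "\<And>x. \<Psi> (\<Phi> x) = x"
    using bialgebra_aut_inverse[OF assms] by blast
  have S: "lin antipode" "conv antipode id = eps" "conv id antipode = eps"
    using is_antipode_antipode by (auto simp: is_antipode_iff)
  have lin: "lin \<Phi>" "lin \<Psi>" and one: "\<Phi> 1 = 1" and counit: "\<And>x. counit (\<Psi> x) = counit x"
    using assms \<Psi>(1) by (auto simp: bialgebra_aut_iff coalg_hom_def)
  have eps: "\<Phi> (eps (\<Psi> x)) = eps x" for x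
    by (simp add: eps_def lin_smult[OF lin(1)] one counit)
  have id: "(\<lambda>x. \<Phi> (id (\<Psi> x))) = id" using \<Psi>(2) by auto
  have "is_antipode (\<lambda>x. \<Phi> (antipode (\<Psi> x)))"
    unfolding is_antipode_iff
  proof (intro conjI ext)
    show "lin (\<lambda>x. \<Phi> (antipode (\<Psi> x)))"
      by (intro lin_compose[OF lin(1)] lin_compose[OF S(1)] lin(2))
    fix x
    show "conv (\<lambda>x. \<Phi> (antipode (\<Psi> x))) id x = eps x"
      using conv_conjugate[OF assms \<Psi>(1) S(1) lin_id, of x] by (simp only: id S eps)
    show "conv id (\<lambda>x. \<Phi> (antipode (\<Psi> x))) x = eps x"
      using conv_conjugate[OF assms \<Psi>(1) lin_id S(1), of x] by (simp only: id S eps)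
  qed
  then have "(\<lambda>x. \<Phi> (antipode (\<Psi> x))) = antipode"
    using is_antipode_antipode by (rule antipode_unique)
  then have "antipode (\<Phi> x) = \<Phi> (antipode (\<Psi> (\<Phi> x)))" for x by metis
  then show ?thesis by (auto simp: \<Psi>(3))
qed

section \<open>The two groups and the restriction homomorphism\<close>

lemma carrier_Aut: "\<Phi> \<in> carrier Aut_bialg \<longleftrightarrow> bialgebra_aut \<Phi>"
  and mult_Aut: "\<Phi> \<otimes>\<^bsub>Aut_bialg\<^esub> \<Psi> = \<Phi> \<circ> \<Psi>"
  and one_Aut: "\<one>\<^bsub>Aut_bialg\<^esub> = id"
  by (simp_all add: Aut_bialg_def)

lemma bialgebra_aut_comp: "bialgebra_aut \<Phi> \<Longrightarrow> bialgebra_aut \<Psi> \<Longrightarrow> bialgebra_aut (\<Phi> \<circ> \<Psi>)"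
  by (auto simp: bialgebra_aut_iff coalg_hom_comp bij_comp)

lemma bialgebra_aut_id: "bialgebra_aut id"
  by (simp add: bialgebra_aut_iff coalg_hom_id)

lemma group_Aut: "group Aut_bialg"
proof (rule groupI; unfold carrier_Aut mult_Aut one_Aut)
  fix \<Phi> assume "bialgebra_aut \<Phi>"
  then obtain \<Psi> where "bialgebra_aut \<Psi>" "\<And>x. \<Psi> (\<Phi> x) = x"
    using bialgebra_aut_inverse by blast
  then show "\<exists>\<Psi>\<in>carrier Aut_bialg. \<Psi> \<circ> \<Phi> = id"
    by (auto simp: carrier_Aut intro!: bexI[of _ \<Psi>])
qed (auto simp: bialgebra_aut_comp bialgebra_aut_id)

lemma carrier_GL: "g \<in> carrier GL_Prim \<longleftrightarrow> g \<in> extensional Prim \<and> bij_betw g Prim Prim \<and>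
    (\<forall>x\<in>Prim. \<forall>y\<in>Prim. g (x + y) = g x + g y) \<and> (\<forall>c. \<forall>x\<in>Prim. g (smult c x) = smult c (g x))"
  and mult_GL: "g \<otimes>\<^bsub>GL_Prim\<^esub> h = compose Prim g h"
  and one_GL: "\<one>\<^bsub>GL_Prim\<^esub> = restrict id Prim"
  by (simp_all add: GL_Prim_def)

lemma GL_inverse:
  assumes "g \<in> carrier GL_Prim"
  shows "restrict (inv_into Prim g) Prim \<in> carrier GL_Prim"
proof -
  let ?h = "inv_into Prim g"
  have g: "bij_betw g Prim Prim" "\<And>x y. x \<in> Prim \<Longrightarrow> y \<in> Prim \<Longrightarrow> g (x + y) = g x + g y"
    "\<And>c x. x \<in> Prim \<Longrightarrow> g (smult c x) = smult c (g x)"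
    using assms by (auto simp: carrier_GL)
  have h: "?h x \<in> Prim" "g (?h x) = x" if "x \<in> Prim" for x
    using that g(1) by (auto simp: bij_betw_def inv_into_into f_inv_into_f)
  have hg: "?h (g x) = x" if "x \<in> Prim" for x
    using that g(1) by (auto simp: bij_betw_def)
  have "?h (x + y) = ?h x + ?h y" if "x \<in> Prim" "y \<in> Prim" for x y
    using hg[of "?h x + ?h y"] h that by (simp add: g Prim_add)
  moreover have "?h (smult c x) = smult c (?h x)" if "x \<in> Prim" for c x
    using hg[of "smult c (?h x)"] h that by (simp add: g Prim_smult)
  moreover have "bij_betw (restrict ?h Prim) Prim Prim"
    using bij_betw_inv_into[OF g(1)] by (simp add: bij_betw_restrict_eq)
  ultimately show ?thesis by (simp add: carrier_GL Prim_add Prim_smult)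
qed

lemma group_GL: "group GL_Prim"
proof (rule groupI)
  fix g h k assume g: "g \<in> carrier GL_Prim" and h: "h \<in> carrier GL_Prim" and k: "k \<in> carrier GL_Prim"
  have hP: "h x \<in> Prim" if "x \<in> Prim" for x using h that by (auto simp: carrier_GL bij_betw_def)
  have kP: "k x \<in> Prim" if "x \<in> Prim" for x using k that by (auto simp: carrier_GL bij_betw_def)
  show "g \<otimes>\<^bsub>GL_Prim\<^esub> h \<in> carrier GL_Prim"
    using g h hP unfolding mult_GL carrier_GL
    by (auto simp: compose_eq Prim_add Prim_smult intro: bij_betw_compose)
  show "g \<otimes>\<^bsub>GL_Prim\<^esub> h \<otimes>\<^bsub>GL_Prim\<^esub> k = g \<otimes>\<^bsub>GL_Prim\<^esub> (h \<otimes>\<^bsub>GL_Prim\<^esub> k)"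
    unfolding mult_GL by (rule compose_assoc[symmetric]) (use kP in auto)
  show "\<one>\<^bsub>GL_Prim\<^esub> \<otimes>\<^bsub>GL_Prim\<^esub> h = h"
    unfolding mult_GL one_GL
    by (rule extensionalityI[of _ Prim]) (use h hP in \<open>auto simp: compose_eq carrier_GL\<close>)
  have "restrict (inv_into Prim g) Prim \<otimes>\<^bsub>GL_Prim\<^esub> g = \<one>\<^bsub>GL_Prim\<^esub>"
    using g compose_inv_into_id[of g Prim Prim] by (simp add: mult_GL one_GL carrier_GL id_def)
  then show "\<exists>g'\<in>carrier GL_Prim. g' \<otimes>\<^bsub>GL_Prim\<^esub> g = \<one>\<^bsub>GL_Prim\<^esub>"
    using GL_inverse[OF g] by blast
next
  show "\<one>\<^bsub>GL_Prim\<^esub> \<in> carrier GL_Prim"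
    by (auto simp: one_GL carrier_GL Prim_add Prim_smult bij_betw_def)
qed

text \<open>The inverse automorphism also preserves primitive elements, hence the restriction is
  onto \<open>Prim\<close> and not merely injective.\<close>

lemma chi_hom: "chi \<in> hom Aut_bialg GL_Prim"
proof (rule homI; unfold carrier_Aut mult_Aut mult_GL)
  fix \<Phi> assume \<Phi>: "bialgebra_aut \<Phi>"
  obtain \<Psi> where \<Psi>: "bialgebra_aut \<Psi>" "\<And>x. \<Phi> (\<Psi> x) = x" "\<And>x. \<Psi> (\<Phi> x) = x"
    using bialgebra_aut_inverse[OF \<Phi>] by blast
  have "lin \<Phi>" using \<Phi> by (auto simp: bialgebra_aut_iff coalg_hom_def)
  have P: "\<Phi> x \<in> Prim" "\<Psi> x \<in> Prim" if "x \<in> Prim" for x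
    using \<Phi> \<Psi>(1) that by (auto simp: bialgebra_aut_iff coalg_hom_Prim)
  have "bij_betw \<Phi> Prim Prim"
    by (rule bij_betw_byWitness[where f' = \<Psi>]) (auto simp: \<Psi> P)
  then have "bij_betw (chi \<Phi>) Prim Prim"
    by (simp add: chi_def bij_betw_restrict_eq)
  then show "chi \<Phi> \<in> carrier GL_Prim"
    by (auto simp: carrier_GL chi_def Prim_add Prim_smult lin_add[OF \<open>lin \<Phi>\<close>] lin_smult[OF \<open>lin \<Phi>\<close>])
next
  fix \<Phi> \<Psi> assume "bialgebra_aut \<Phi>" "bialgebra_aut \<Psi>"
  then show "chi (\<Phi> \<circ> \<Psi>) = compose Prim (chi \<Phi>) (chi \<Psi>)"
    by (auto simp: chi_def compose_def restrict_def fun_eq_iff bialgebra_aut_iff coalg_hom_Prim)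
qed

section \<open>Lifting linear automorphisms and the complement of the kernel\<close>

context prim_projection
begin

lemma GL_lift_coalg:
  assumes "g \<in> carrier GL_Prim"
  obtains \<Phi> where "coalg_hom \<Phi>" "\<And>x. proj (\<Phi> x) = g (proj x)"
proof (rule coalg_hom_lift[of "\<lambda>x. g (proj x)"])
  have g: "\<And>x. x \<in> Prim \<Longrightarrow> g x \<in> Prim" "\<And>x y. x \<in> Prim \<Longrightarrow> y \<in> Prim \<Longrightarrow> g (x + y) = g x + g y"
    "\<And>c x. x \<in> Prim \<Longrightarrow> g (smult c x) = smult c (g x)"
    using assms by (auto simp: carrier_GL bij_betw_def)
  show "lin (\<lambda>x. g (proj x))"
    by (simp add: lin_def lin_add[OF lin_proj] lin_smult[OF lin_proj] g proj_in_Prim)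
  show "g (proj x) \<in> Prim" for x by (simp add: g proj_in_Prim)
  show "g (proj 1) = 0" using g(3)[of 0 0] by (simp add: proj_one Prim_zero)
qed (use that in blast)

text \<open>Lifts of \<open>g\<close> and of its inverse compose to coalgebra endomorphisms
  compatible with \<open>proj\<close>, which are the identity by rigidity; this gives bijectivity.
  Multiplicativity holds since \<open>proj (\<Phi> (x * y)) = g (proj (x * y)) = g 0 = 0\<close> on
  the augmentation ideal.\<close>

lemma GL_lift:
  assumes g: "g \<in> carrier GL_Prim"
  obtains \<Phi> where "bialgebra_aut \<Phi>" "\<And>x. proj (\<Phi> x) = \<Phi> (proj x)" "chi \<Phi> = g"
proof -
  define h where "h = restrict (inv_into Prim g) Prim"
  have h: "h \<in> carrier GL_Prim" unfolding h_def by (rule GL_inverse[OF g])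
  have inv: "h (g x) = x" "g (h x) = x" if "x \<in> Prim" for x
    using that g by (auto simp: h_def carrier_GL bij_betw_def f_inv_into_f)
  obtain \<Phi> where \<Phi>: "coalg_hom \<Phi>" "\<And>x. proj (\<Phi> x) = g (proj x)" using GL_lift_coalg[OF g] by blast
  obtain \<Psi> where \<Psi>: "coalg_hom \<Psi>" "\<And>x. proj (\<Psi> x) = h (proj x)" using GL_lift_coalg[OF h] by blast
  have "\<Phi> \<circ> \<Psi> = id" "\<Psi> \<circ> \<Phi> = id"
    by (rule coalg_hom_eq_id; simp add: coalg_hom_comp \<Phi> \<Psi> inv proj_in_Prim)+
  then have "bij \<Phi>" by (metis o_bij)
  have "g 0 = 0"
    using g Prim_zero smult_simps(1) unfolding carrier_GL by metis
  then have "\<Phi> (x * y) = \<Phi> x * \<Phi> y" for x y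
    by (intro coalg_hom_mult \<Phi>(1)) (simp add: \<Phi>(2) proj_mult)
  then have "bialgebra_aut \<Phi>" using \<open>bij \<Phi>\<close> \<Phi>(1) by (simp add: bialgebra_aut_iff)
  moreover have \<Phi>g: "\<Phi> x = g x" if "x \<in> Prim" for x
    using \<Phi>(2)[of x] that coalg_hom_Prim[OF \<Phi>(1) that] by (simp add: proj_Prim)
  then have "proj (\<Phi> x) = \<Phi> (proj x)" for x by (simp add: \<Phi>(2) proj_in_Prim)
  moreover have "chi \<Phi> = g"
    unfolding chi_def
    by (rule extensionalityI[of _ Prim]) (use g \<Phi>g in \<open>auto simp: carrier_GL\<close>)
  ultimately show ?thesis using that by blast
qed

text \<open>The complement consists of the automorphisms commuting with \<open>proj\<close>;
  \<open>GL_lift\<close> supplies one over each linear automorphism of the primitives.\<close>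

lemma semidirect:
  defines "L \<equiv> {\<Phi>. bialgebra_aut \<Phi> \<and> (\<forall>x. proj (\<Phi> x) = \<Phi> (proj x))}"
  shows "subgroup L Aut_bialg"
    and "kernel Aut_bialg GL_Prim chi \<inter> L = {\<one>\<^bsub>Aut_bialg\<^esub>}"
    and "kernel Aut_bialg GL_Prim chi <#>\<^bsub>Aut_bialg\<^esub> L = carrier Aut_bialg"
    and "bij_betw chi L (carrier GL_Prim)"
proof -
  interpret group_hom Aut_bialg GL_Prim chi
    by (simp add: group_hom_def group_hom_axioms_def group_Aut group_GL chi_hom)
  let ?K = "kernel Aut_bialg GL_Prim chi"
  show sub: "subgroup L Aut_bialg"
  proof (rule G.subgroupI)
    show "L \<subseteq> carrier Aut_bialg" by (auto simp: L_def carrier_Aut)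
    show "L \<noteq> {}" using bialgebra_aut_id by (auto simp: L_def intro!: exI[of _ id])
    fix \<Phi> assume \<Phi>: "\<Phi> \<in> L"
    then have c: "\<Phi> \<in> carrier Aut_bialg" by (simp add: L_def carrier_Aut)
    let ?\<Psi> = "inv\<^bsub>Aut_bialg\<^esub> \<Phi>"
    have "\<Phi> (?\<Psi> x) = x" "?\<Psi> (\<Phi> x) = x" for x
      using G.r_inv[OF c] G.l_inv[OF c] by (auto simp: mult_Aut one_Aut fun_eq_iff)
    moreover have "proj (\<Phi> (?\<Psi> x)) = \<Phi> (proj (?\<Psi> x))" for x
      using \<Phi> by (simp add: L_def)
    ultimately have "proj (?\<Psi> x) = ?\<Psi> (proj x)" for x by metis
    then show "?\<Psi> \<in> L" using G.inv_closed[OF c] by (simp add: L_def carrier_Aut)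
    fix \<Psi> assume "\<Psi> \<in> L"
    with \<Phi> show "\<Phi> \<otimes>\<^bsub>Aut_bialg\<^esub> \<Psi> \<in> L" by (simp add: L_def mult_Aut bialgebra_aut_comp)
  qed
  have "\<Phi> = id" if "\<Phi> \<in> ?K" "\<Phi> \<in> L" for \<Phi>
  proof (rule coalg_hom_eq_id)
    show "coalg_hom \<Phi>" using that by (simp add: L_def bialgebra_aut_iff)
    \<comment> \<open>Fixing the range of \<open>proj\<close> and commuting with \<open>proj\<close>
      together give \<open>proj \<circ> \<Phi> = proj\<close>, the hypothesis of the rigidity
      lemma.\<close>
    have "\<Phi> p = p" if "p \<in> Prim" for p
      using \<open>\<Phi> \<in> ?K\<close> that by (auto simp: kernel_def one_GL chi_def restrict_def fun_eq_iff split: if_splits)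
    then show "proj (\<Phi> x) = proj x" for x using that by (simp add: L_def proj_in_Prim)
  qed
  moreover have "id \<in> ?K" using G.one_closed hom_one by (simp add: kernel_def one_Aut)
  moreover have "id \<in> L" using bialgebra_aut_id by (simp add: L_def)
  ultimately show KL: "?K \<inter> L = {\<one>\<^bsub>Aut_bialg\<^esub>}" by (auto simp: one_Aut)
  have Lc: "L \<subseteq> carrier Aut_bialg" by (rule subgroup.subset[OF sub])
  have lift: "\<exists>\<Psi>\<in>L. chi \<Psi> = g" if "g \<in> carrier GL_Prim" for g
    by (rule GL_lift[OF that]) (auto simp: L_def)
  show "?K <#>\<^bsub>Aut_bialg\<^esub> L = carrier Aut_bialg"
  proof
    show "?K <#>\<^bsub>Aut_bialg\<^esub> L \<subseteq> carrier Aut_bialg"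
      using Lc by (auto simp: set_mult_def kernel_def)
    show "carrier Aut_bialg \<subseteq> ?K <#>\<^bsub>Aut_bialg\<^esub> L"
    proof
      fix \<Phi> assume \<Phi>: "\<Phi> \<in> carrier Aut_bialg"
      \<comment> \<open>Dividing \<Phi> by the element of \<open>L\<close> with the same restriction
        leaves a factor in the kernel.\<close>
      obtain \<Psi> where \<Psi>: "\<Psi> \<in> L" "chi \<Psi> = chi \<Phi>" using lift[OF hom_closed[OF \<Phi>]] by blast
      have c: "\<Psi> \<in> carrier Aut_bialg" using \<Psi> Lc by blast
      have "\<Phi> \<otimes>\<^bsub>Aut_bialg\<^esub> inv\<^bsub>Aut_bialg\<^esub> \<Psi> \<in> ?K"
        using \<Phi> c \<Psi>(2) by (simp add: kernel_def)
      moreover have "\<Phi> = (\<Phi> \<otimes>\<^bsub>Aut_bialg\<^esub> inv\<^bsub>Aut_bialg\<^esub> \<Psi>) \<otimes>\<^bsub>Aut_bialg\<^esub> \<Psi>"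
        using \<Phi> c by (simp add: G.m_assoc)
      ultimately show "\<Phi> \<in> ?K <#>\<^bsub>Aut_bialg\<^esub> L" using \<Psi>(1) unfolding set_mult_def by blast
    qed
  qed
  have "inj_on chi L"
  proof (rule inj_onI)
    fix \<Phi> \<Psi> assume *: "\<Phi> \<in> L" "\<Psi> \<in> L" "chi \<Phi> = chi \<Psi>"
    then have c: "\<Phi> \<in> carrier Aut_bialg" "\<Psi> \<in> carrier Aut_bialg" using Lc by auto
    \<comment> \<open>Two elements of \<open>L\<close> with the same restriction differ by an
      element of the trivial intersection.\<close>
    have "\<Phi> \<otimes>\<^bsub>Aut_bialg\<^esub> inv\<^bsub>Aut_bialg\<^esub> \<Psi> \<in> ?K \<inter> L"
      using * c by (simp add: kernel_def subgroup.m_closed[OF sub] subgroup.m_inv_closed[OF sub])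
    then have "\<Phi> \<otimes>\<^bsub>Aut_bialg\<^esub> inv\<^bsub>Aut_bialg\<^esub> \<Psi> = \<one>\<^bsub>Aut_bialg\<^esub>" using KL by blast
    then show "\<Phi> = \<Psi>" using c by (metis G.inv_equality G.inv_inv G.inv_closed)
  qed
  moreover have "chi ` L = carrier GL_Prim"
    using lift hom_closed Lc by auto
  ultimately show "bij_betw chi L (carrier GL_Prim)" by (simp add: bij_betw_def)
qed

end

theorem theorem12p5:
  shows "{\<Phi>. bialgebra_aut \<Phi>} = {\<Phi>. hopf_aut \<Phi>}
    \<and> group Aut_bialg \<and> group GL_Prim
    \<and> chi \<in> hom Aut_bialg GL_Prim
    \<and> chi ` carrier Aut_bialg = carrier GL_Prim
    \<and> kernel Aut_bialg GL_Prim chi \<lhd> Aut_bialg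
    \<and> (\<exists>L. subgroup L Aut_bialg
         \<and> kernel Aut_bialg GL_Prim chi \<inter> L = {\<one>\<^bsub>Aut_bialg\<^esub>}
         \<and> kernel Aut_bialg GL_Prim chi <#>\<^bsub>Aut_bialg\<^esub> L = carrier Aut_bialg
         \<and> bij_betw chi L (carrier GL_Prim))"
proof -
  interpret group_hom Aut_bialg GL_Prim chi
    by (simp add: group_hom_def group_hom_axioms_def group_Aut group_GL chi_hom)
  \<comment> \<open>The choice of a projection fixes the complement \<open>L\<close>, hence the
    splitting of \<chi>.\<close>
  obtain proj where proj: "prim_projection proj" using prim_projection_ex by blast
  note semidirect = prim_projection.semidirect[OF proj]
  have "{\<Phi>. bialgebra_aut \<Phi>} = {\<Phi>. hopf_aut \<Phi>}"
    using bialgebra_aut_antipode by (auto simp: hopf_aut_def)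
  moreover have "chi ` carrier Aut_bialg = carrier GL_Prim"
    using semidirect(4) subgroup.subset[OF semidirect(1)] hom_closed
    unfolding bij_betw_def by blast
  ultimately show ?thesis
    using group_Aut group_GL chi_hom normal_kernel semidirect by blast
qed

end
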